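(* Let $\Gamma$ be the state-blind zero-sum repeated game described in the context, and let $v_\lambda(1^{++})$ be the value of its $\lambda$-discounted game with initial state $1^{++}$. Then $(v_\lambda(1^{++}))$ does not converge when $\lambda\to0$.
   Context: State-blind zero-sum repeated game: finite state space $K$, finite action sets $I$ (Player 1), $J$ (Player 2), transition $q:K\times I\times J\to\Delta(K)$, payoff $g:K\to\mathbb{R}$, all known to both players. The initial state $k_1$ is (here) a given state known to both players. At each stage $m\ge1$ the players simultaneously and independently choose $i_m\in I$, $j_m\in J$, the stage payoff is $g_m=g(k_m)$, the next state $k_{m+1}$ is drawn from $q(k_m,i_m,j_m)$, and both players observe $(i_m,j_m)$ only (no signal about the state is received). Behavior strategies map finite sequences of past action pairs to probability distributions on the player's action set. For $\lambda\in(0,1]$ the $\lambda$-discounted game has payoff $\mathbb{E}\big(\sum_{m\ge1}\lambda(1-\lambda)^{m-1}g_m\big)$, maximized by Player 1 and minimized by Player 2; $v_\lambda(k)$ denotes its value when the initial state is $k$. The particular game: $K=\{1^*,1^{++},1^T,1^+,0^*,0^{++},0^+\}$, $I=\{T,B,Q\}$, $J=\{L,R,Q\}$. States $0^*$ and $1^*$ are absorbing. The payoff is $1$ in states $1^{++},1^T,1^+,1^*$ and $0$ in states $0^{++},0^+,0^*$, whatever the actions. Transitions ($\alpha\cdot k+\beta\cdot k'$ means $k$ with probability $\alpha$, $k'$ with probability $\beta$; action pairs are (Player 1, Player 2)): - From each of $1^{++},1^T,1^+$: if Player 1 plays $Q$ (whatever Player 2 plays), the next state is $0^*$. - $1^{++}$: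 $(T,L),(B,R)\mapsto 1^{++}$; $(T,R),(B,L)\mapsto 1^T$; $(T,Q),(B,Q)\mapsto 1^*$. - $1^T$: $(T,L),(B,R)\mapsto 1^{++}$; $(T,R),(B,L)\mapsto \frac34\cdot1^++\frac14\cdot1^{++}$; $(T,Q),(B,Q)\mapsto 1^*$. - $1^+$: $(T,L),(B,R)\mapsto 1^{++}$; $(T,R),(B,L)\mapsto 1^+$; $(T,Q),(B,Q)\mapsto 0^{++}$. - From each of $0^{++},0^+$: if Player 2 plays $Q$ (whatever Player 1 plays), the next state is $1^*$. - $0^{++}$: $(T,L),(B,R)\mapsto \frac12\cdot0^{++}+\frac12\cdot0^+$; $(T,R),(B,L)\mapsto 0^{++}$; $(Q,L),(Q,R)\mapsto 0^*$. - $0^+$: $(T,L),(B,R)\mapsto 0^+$; $(T,R),(B,L)\mapsto 0^{++}$; $(Q,L),(Q,R)\mapsto 1^{++}$. *)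

theory Defs
  imports "HOL-Probability.Probability"
begin

text \<open>State-blind zero-sum repeated games. Stages are numbered from 0, so index m stands for
  stage m + 1. A play is a sequence of triples (state, action of Player 1, action of Player 2);
  the two players observe only the action pairs. The finiteness of the three sets is a sort
  constraint.\<close>

type_synonym ('i, 'j) history = "('i \<times> 'j) list"
type_synonym ('i, 'j) strategy1 = "('i, 'j) history \<Rightarrow> 'i pmf"
type_synonym ('i, 'j) strategy2 = "('i, 'j) history \<Rightarrow> 'j pmf"
type_synonym ('k, 'i, 'j) play = "nat \<Rightarrow> 'k \<times> 'i \<times> 'j"
type_synonym ('k, 'i, 'j) transition = "'k \<Rightarrow> 'i \<Rightarrow> 'j \<Rightarrow> 'k pmf"

definition past_actions :: "('k, 'i, 'j) play \<Rightarrow> nat \<Rightarrow> ('i, 'j) history" where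
  "past_actions \<omega> n = map (\<lambda>m. snd (\<omega> m)) [0..<n]"

definition state_law :: "('k, 'i, 'j) transition \<Rightarrow> 'k \<Rightarrow> nat \<Rightarrow> ('k, 'i, 'j) play \<Rightarrow> 'k pmf" where
  "state_law q k1 n \<omega> =
     (case n of 0 \<Rightarrow> return_pmf k1 | Suc m \<Rightarrow> (case \<omega> m of (k, i, j) \<Rightarrow> q k i j))"

text \<open>The conditional law of the triple with index n, given the triples with smaller index.\<close>

definition stage_law ::
  "('k, 'i, 'j) transition \<Rightarrow> 'k \<Rightarrow> ('i, 'j) strategy1 \<Rightarrow> ('i, 'j) strategy2 \<Rightarrow>
   nat \<Rightarrow> ('k, 'i, 'j) play \<Rightarrow> ('k \<times> 'i \<times> 'j) pmf" where
  "stage_law q k1 \<sigma> \<tau> n \<omega> =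
     pair_pmf (state_law q k1 n \<omega>)
       (pair_pmf (\<sigma> (past_actions \<omega> n)) (\<tau> (past_actions \<omega> n)))"

text \<open>The probability on plays induced by the initial state and the strategies: the
  Ionescu-Tulcea extension of the laws above.\<close>

definition play_measure ::
  "('k::finite, 'i::finite, 'j::finite) transition \<Rightarrow> 'k \<Rightarrow>
   ('i, 'j) strategy1 \<Rightarrow> ('i, 'j) strategy2 \<Rightarrow> ('k, 'i, 'j) play measure" where
  "play_measure q k1 \<sigma> \<tau> =
     projective_family.lim UNIV
       (Ionescu_Tulcea.CI (\<lambda>n \<omega>. measure_pmf (stage_law q k1 \<sigma> \<tau> n \<omega>)) (\<lambda>_. count_space UNIV))
       (\<lambda>_. count_space UNIV)"

lemma stage_law_restrict:
  "stage_law q k1 \<sigma> \<tau> n (restrict \<omega> {0..<n}) = stage_law q k1 \<sigma> \<tau> n \<omega>"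
proof -
  have "past_actions (restrict \<omega> {0..<n}) n = past_actions \<omega> n"
    by (simp add: past_actions_def)
  moreover have "state_law q k1 n (restrict \<omega> {0..<n}) = state_law q k1 n \<omega>"
    by (simp add: state_law_def split: nat.split)
  ultimately show ?thesis
    by (simp add: stage_law_def)
qed

lemma Ionescu_Tulcea_stage_law:
  fixes q :: "('k::finite, 'i::finite, 'j::finite) transition"
  shows "Ionescu_Tulcea (\<lambda>n \<omega>. measure_pmf (stage_law q k1 \<sigma> \<tau> n \<omega>)) (\<lambda>_. count_space UNIV)"
proof
  fix n :: nat
  have eq: "PiM {0..<n} (\<lambda>_. count_space (UNIV :: ('k \<times> 'i \<times> 'j) set)) =
      count_space (PiE {0..<n} (\<lambda>_. UNIV))"
    by (rule count_space_PiM_finite) auto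
  show "(\<lambda>\<omega>. measure_pmf (stage_law q k1 \<sigma> \<tau> n \<omega>)) \<in>
      measurable (PiM {0..<n} (\<lambda>_. count_space UNIV)) (subprob_algebra (count_space UNIV))"
    unfolding eq by (auto simp: measure_pmf_in_subprob_algebra)
qed

lemma prob_space_play_measure: "prob_space (play_measure q k1 \<sigma> \<tau>)"
proof -
  interpret Ionescu_Tulcea "\<lambda>n \<omega>. measure_pmf (stage_law q k1 \<sigma> \<tau> n \<omega>)" "\<lambda>_. count_space UNIV"
    by (rule Ionescu_Tulcea_stage_law)
  have "prob_space PF.lim"
  proof (rule prob_space_distrD)
    show "(\<lambda>\<omega>. restrict \<omega> {}) \<in> measurable PF.lim (PiM {} (\<lambda>_. count_space UNIV))"
      by (simp add: measurable_cong_sets[OF PF.sets_lim refl])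
    show "prob_space (distr PF.lim (PiM {} (\<lambda>_. count_space UNIV)) (\<lambda>\<omega>. restrict \<omega> {}))"
      using PF.prob_space_P[of "{}"] by (simp only: distr_lim[of "{}"] finite.emptyI empty_subsetI)
  qed
  then show ?thesis by (simp add: play_measure_def)
qed

definition discounted_payoff ::
  "('k::finite, 'i::finite, 'j::finite) transition \<Rightarrow> ('k \<Rightarrow> real) \<Rightarrow> real \<Rightarrow> 'k \<Rightarrow>
   ('i, 'j) strategy1 \<Rightarrow> ('i, 'j) strategy2 \<Rightarrow> real" where
  "discounted_payoff q g lam k1 \<sigma> \<tau> =
     (\<integral>\<omega>. (\<Sum>m. lam * (1 - lam) ^ m * g (fst (\<omega> m))) \<partial>play_measure q k1 \<sigma> \<tau>)"

definition is_discounted_value ::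
  "('k::finite, 'i::finite, 'j::finite) transition \<Rightarrow> ('k \<Rightarrow> real) \<Rightarrow> real \<Rightarrow> 'k \<Rightarrow> real \<Rightarrow> bool" where
  "is_discounted_value q g lam k1 v \<longleftrightarrow>
     (SUP \<sigma>. INF \<tau>. discounted_payoff q g lam k1 \<sigma> \<tau>) = v \<and>
     (INF \<tau>. SUP \<sigma>. discounted_payoff q g lam k1 \<sigma> \<tau>) = v"

definition discounted_value ::
  "('k::finite, 'i::finite, 'j::finite) transition \<Rightarrow> ('k \<Rightarrow> real) \<Rightarrow> real \<Rightarrow> 'k \<Rightarrow> real" where
  "discounted_value q g lam k1 = (THE v. is_discounted_value q g lam k1 v)"

text \<open>The particular game. In the state names, \<open>s\<close> stands for the star of an absorbing state,
  \<open>p\<close> for a superscript plus and \<open>pp\<close> for a double plus.\<close>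

datatype state = K1s | K1pp | K1T | K1p | K0s | K0pp | K0p
datatype action1 = T | B | Q1
datatype action2 = L | R | Q2

instance state :: finite
proof
  have "(UNIV :: state set) = {K1s, K1pp, K1T, K1p, K0s, K0pp, K0p}"
    using state.exhaust by blast
  then show "finite (UNIV :: state set)" by (metis finite.emptyI finite_insert)
qed

instance action1 :: finite
proof
  have "(UNIV :: action1 set) = {T, B, Q1}"
    using action1.exhaust by blast
  then show "finite (UNIV :: action1 set)" by (metis finite.emptyI finite_insert)
qed

instance action2 :: finite
proof
  have "(UNIV :: action2 set) = {L, R, Q2}"
    using action2.exhaust by blast
  then show "finite (UNIV :: action2 set)" by (metis finite.emptyI finite_insert)
qed

definition mix :: "real \<Rightarrow> 'k \<Rightarrow> 'k \<Rightarrow> 'k pmf" where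
  "mix p k k' = map_pmf (\<lambda>b. if b then k else k') (bernoulli_pmf p)"

fun transition :: "(state, action1, action2) transition" where
  "transition K1s _ _ = return_pmf K1s"
| "transition K0s _ _ = return_pmf K0s"

| "transition K1pp Q1 _ = return_pmf K0s"
| "transition K1pp T L = return_pmf K1pp"
| "transition K1pp B R = return_pmf K1pp"
| "transition K1pp T R = return_pmf K1T"
| "transition K1pp B L = return_pmf K1T"
| "transition K1pp T Q2 = return_pmf K1s"
| "transition K1pp B Q2 = return_pmf K1s"

| "transition K1T Q1 _ = return_pmf K0s"
| "transition K1T T L = return_pmf K1pp"
| "transition K1T B R = return_pmf K1pp"
| "transition K1T T R = mix (3/4) K1p K1pp"
| "transition K1T B L = mix (3/4) K1p K1pp"
| "transition K1T T Q2 = return_pmf K1s"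
| "transition K1T B Q2 = return_pmf K1s"

| "transition K1p Q1 _ = return_pmf K0s"
| "transition K1p T L = return_pmf K1pp"
| "transition K1p B R = return_pmf K1pp"
| "transition K1p T R = return_pmf K1p"
| "transition K1p B L = return_pmf K1p"
| "transition K1p T Q2 = return_pmf K0pp"
| "transition K1p B Q2 = return_pmf K0pp"

| "transition K0pp _ Q2 = return_pmf K1s"
| "transition K0pp T L = mix (1/2) K0pp K0p"
| "transition K0pp B R = mix (1/2) K0pp K0p"
| "transition K0pp T R = return_pmf K0pp"
| "transition K0pp B L = return_pmf K0pp"
| "transition K0pp Q1 L = return_pmf K0s"
| "transition K0pp Q1 R = return_pmf K0s"

| "transition K0p _ Q2 = return_pmf K1s"
| "transition K0p T L = return_pmf K0p"
| "transition K0p B R = return_pmf K0p"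
| "transition K0p T R = return_pmf K0pp"
| "transition K0p B L = return_pmf K0pp"
| "transition K0p Q1 L = return_pmf K1pp"
| "transition K0p Q1 R = return_pmf K1pp"

definition payoff :: "state \<Rightarrow> real" where
  "payoff k = (if k \<in> {K1s, K1pp, K1T, K1p} then 1 else 0)"

end

theory Submission
  imports Defs "HOL-Real_Asymp.Real_Asymp"
begin

text \<open>
  Actions carry no private information about the state, so both players share a belief, which the
  past action pairs determine. In the states with payoff 1 Player 1 should never quit; call the
  pairs (T, L) and (B, R) a match and the pairs (T, R) and (B, L) a mismatch. A match brings the
  state back to \<open>K1pp\<close>, and after n consecutive mismatches the state is \<open>K1p\<close> except with probability
  \<open>4 ^ - (n div 2)\<close>. If Player 2 then quits, the state becomes \<open>K0pp\<close>, with payoff 0, but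
  with that probability it is absorbed with payoff 1. The states with payoff 0 work in the same way
  for Player 1, with matches and mismatches exchanged and with risk \<open>2 ^ - n\<close> after n matches. Each
  player can make matches and mismatches equally likely by playing two actions with probability 1/2,
  whatever the opponent does. So the only real decision is the length of the run at which the
  player who dislikes the current payoff quits, and the value solves a pair of optimal stopping
  equations (\<open>bellman\<close>, \<open>value_eq_fixpoint\<close>).

  A run of length n takes about \<open>2 ^ (n + 1)\<close> stages to appear. Hence the quitting player minimises
  the risk plus \<open>lam\<close> times this waiting time. For a risk p, Player 1 faces \<open>p + 2 * lam / p\<close> with p a power
  of 1/2, while Player 2 faces the same function but with p restricted to powers of 1/4. Writing x
  for the minimal cost of Player 2 and y for the one of Player 1, the value is close to
  \<open>x / (x + y)\<close>. Along \<open>lam = (1/2) ^ (2 * m + 1)\<close> the best risk is \<open>(1/2) ^ m\<close>. For even m both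
  players can choose it, and the value is near 1/2; for odd m Player 2 cannot, the cost is larger
  by the factor 5/4, and the value is near 5/9.

  The rigorous version uses \<open>X\<close> for the value at \<open>K1pp\<close> and \<open>Y\<close> for the value at \<open>K0pp\<close>, and bounds
  \<open>X - Y\<close> from both sides by each stopping problem (\<open>value_gap_bounds\<close>). A limit l would have to
  satisfy \<open>2 * l \<le> 2 * (1 - l)\<close> from even m and \<open>(5/2) * (1 - l) \<le> 2 * l\<close> from odd m.
\<close>

section \<open>The law of the state in terms of public histories\<close>

text \<open>Since the sets are finite, the law of the first n stages is discrete. A path is undefined from
  stage n on, as are the elements of the product space over the first n indices.\<close>

primrec path_pmf :: "('k, 'i, 'j) transition \<Rightarrow> 'k \<Rightarrow> ('i, 'j) strategy1 \<Rightarrow> ('i, 'j) strategy2 \<Rightarrow>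
   nat \<Rightarrow> ('k, 'i, 'j) play pmf" where
  "path_pmf q k1 \<sigma> \<tau> 0 = return_pmf (\<lambda>_. undefined)"
| "path_pmf q k1 \<sigma> \<tau> (Suc n) =
     bind_pmf (path_pmf q k1 \<sigma> \<tau> n) (\<lambda>\<omega>. map_pmf (fun_upd \<omega> n) (stage_law q k1 \<sigma> \<tau> n \<omega>))"

lemma PiM_initial_segment:
  "PiM {0..<n::nat} (\<lambda>_. count_space (UNIV :: ('a::finite) set)) = count_space (PiE {0..<n} (\<lambda>_. UNIV))"
  by (rule count_space_PiM_finite) auto

lemma nn_integral_initial_segment:
  fixes q :: "('k::finite, 'i::finite, 'j::finite) transition"
  shows "(\<integral>\<^sup>+\<omega>. f \<omega> \<partial>Ionescu_Tulcea.C (\<lambda>n \<omega>. measure_pmf (stage_law q k1 \<sigma> \<tau> n \<omega>))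
            (\<lambda>_. count_space UNIV) 0 n (\<lambda>_. undefined)) =
         (\<integral>\<^sup>+\<omega>. f \<omega> \<partial>measure_pmf (path_pmf q k1 \<sigma> \<tau> n))"
proof -
  interpret Ionescu_Tulcea "\<lambda>n \<omega>. measure_pmf (stage_law q k1 \<sigma> \<tau> n \<omega>)" "\<lambda>_. count_space UNIV"
    by (rule Ionescu_Tulcea_stage_law)
  have start: "(\<lambda>_. undefined) \<in> space (PiM {0..<0::nat} (\<lambda>_. count_space (UNIV :: ('k \<times> 'i \<times> 'j) set)))"
    by (simp add: space_PiM)
  show ?thesis
  proof (induction n arbitrary: f)
    case 0
    have "f \<in> borel_measurable (PiM {0..<0} (\<lambda>_. count_space UNIV))"
      by (subst PiM_initial_segment) simp
    then have "(\<integral>\<^sup>+\<omega>. f \<omega> \<partial>C 0 0 (\<lambda>_. undefined)) = f (\<lambda>_. undefined)"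
      unfolding C.simps by (intro nn_integral_return start)
    then show ?case by simp
  next
    case (Suc n)
    have sp: "space (C 0 n (\<lambda>_. undefined)) = space (PiM {0..<n} (\<lambda>_. count_space UNIV))"
      using space_C[OF start, of n] by simp
    have st: "sets (C 0 n (\<lambda>_. undefined)) = sets (PiM {0..<n} (\<lambda>_. count_space UNIV))"
      using sets_C[OF start, of n] by simp
    have f: "f \<in> borel_measurable (PiM {0..<Suc n} (\<lambda>_. count_space UNIV))"
      by (simp add: PiM_initial_segment)
    have "(\<integral>\<^sup>+\<omega>. f \<omega> \<partial>C 0 (Suc n) (\<lambda>_. undefined)) =
          (\<integral>\<^sup>+\<omega>. \<integral>\<^sup>+\<omega>'. f \<omega>' \<partial>eP n \<omega> \<partial>C 0 n (\<lambda>_. undefined))"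
      using measurable_eP[of n] f
      by (simp add: nn_integral_bind[where B="PiM {0..<Suc n} (\<lambda>_. count_space UNIV)"]
          measurable_cong_sets[OF st refl])
    also have "\<dots> = (\<integral>\<^sup>+\<omega>. \<integral>\<^sup>+x. f (fun_upd \<omega> n x) \<partial>measure_pmf (stage_law q k1 \<sigma> \<tau> n \<omega>)
        \<partial>C 0 n (\<lambda>_. undefined))"
      by (intro nn_integral_cong nn_integral_eP f) (simp add: sp)
    finally show ?case
      by (simp only: Suc.IH path_pmf.simps nn_integral_bind_pmf nn_integral_map_pmf)
  qed
qed

text \<open>Everything that is observed in finitely many stages can be computed with discrete laws, because
  the Ionescu-Tulcea extension restricts to its finite stages.\<close>

lemma distr_play_measure:
  fixes F :: "('k::finite, 'i::finite, 'j::finite) play \<Rightarrow> 'b"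
  assumes F: "\<And>\<omega>. F (restrict \<omega> {0..<n}) = F \<omega>"
  shows "F \<in> measurable (play_measure q k1 \<sigma> \<tau>) (count_space UNIV)"
    and "distr (play_measure q k1 \<sigma> \<tau>) (count_space UNIV) F = measure_pmf (map_pmf F (path_pmf q k1 \<sigma> \<tau> n))"
proof -
  interpret Ionescu_Tulcea "\<lambda>n \<omega>. measure_pmf (stage_law q k1 \<sigma> \<tau> n \<omega>)" "\<lambda>_. count_space UNIV"
    by (rule Ionescu_Tulcea_stage_law)
  let ?P = "PiM {0..<n} (\<lambda>_. count_space (UNIV :: ('k \<times> 'i \<times> 'j) set))"
  let ?r = "\<lambda>\<omega>. restrict \<omega> {0..<n}"
  have lim: "play_measure q k1 \<sigma> \<tau> = PF.lim"
    by (simp add: play_measure_def)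
  have r: "?r \<in> measurable (play_measure q k1 \<sigma> \<tau>) ?P"
    unfolding lim by (simp add: measurable_cong_sets[OF PF.sets_lim refl])
  have FP: "F \<in> measurable ?P (count_space UNIV)"
    by (simp add: PiM_initial_segment)
  from measurable_comp[OF r FP] show meas: "F \<in> measurable (play_measure q k1 \<sigma> \<tau>) (count_space UNIV)"
    by (simp add: comp_def F)
  have CI: "CI {0..<n} = C 0 n (\<lambda>_. undefined)"
  proof (rule measure_eqI)
    have start: "(\<lambda>_. undefined) \<in> space (PiM {0..<0::nat} (\<lambda>_. count_space (UNIV :: ('k \<times> 'i \<times> 'j) set)))"
      by (simp add: space_PiM)
    then show "sets (CI {0..<n}) = sets (C 0 n (\<lambda>_. undefined))"
      using sets_C[OF start, of n] by (simp add: CI_def)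
    fix X assume "X \<in> sets (CI {0..<n})"
    then have X: "X \<in> sets ?P"
      by (simp add: CI_def)
    have "prod_emb {0..<n} (\<lambda>_. count_space UNIV) {0..<n} X = X"
      using X by (intro prod_emb_id) (auto simp: PiM_initial_segment)
    then show "emeasure (CI {0..<n}) X = emeasure (C 0 n (\<lambda>_. undefined)) X"
      using emeasure_CI[OF subset_refl X] by simp
  qed
  show "distr (play_measure q k1 \<sigma> \<tau>) (count_space UNIV) F = measure_pmf (map_pmf F (path_pmf q k1 \<sigma> \<tau> n))"
  proof (rule measure_eqI)
    fix A :: "'b set"
    have "emeasure (distr (play_measure q k1 \<sigma> \<tau>) (count_space UNIV) F) A =
        (\<integral>\<^sup>+x. indicator A x \<partial>distr (play_measure q k1 \<sigma> \<tau>) (count_space UNIV) F)"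
      by (simp add: nn_integral_indicator)
    also have "\<dots> = (\<integral>\<^sup>+\<omega>. indicator A (F (?r \<omega>)) \<partial>play_measure q k1 \<sigma> \<tau>)"
      by (subst nn_integral_distr[OF meas]) (simp_all add: F)
    also have "\<dots> = (\<integral>\<^sup>+\<omega>. indicator A (F \<omega>) \<partial>distr (play_measure q k1 \<sigma> \<tau>) ?P ?r)"
      by (subst nn_integral_distr[OF r]) (simp_all add: PiM_initial_segment)
    also have "distr (play_measure q k1 \<sigma> \<tau>) ?P ?r = C 0 n (\<lambda>_. undefined)"
      unfolding lim by (simp add: distr_lim CI)
    also have "(\<integral>\<^sup>+\<omega>. indicator A (F \<omega>) \<partial>C 0 n (\<lambda>_. undefined)) =
        (\<integral>\<^sup>+x. indicator A x \<partial>measure_pmf (map_pmf F (path_pmf q k1 \<sigma> \<tau> n)))"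
      by (simp only: nn_integral_initial_segment nn_integral_map_pmf)
    also have "\<dots> = emeasure (measure_pmf (map_pmf F (path_pmf q k1 \<sigma> \<tau> n))) A"
      by (rule nn_integral_indicator) simp
    finally show "emeasure (distr (play_measure q k1 \<sigma> \<tau>) (count_space UNIV) F) A =
        emeasure (measure_pmf (map_pmf F (path_pmf q k1 \<sigma> \<tau> n))) A" .
  qed simp
qed

text \<open>This is Bayesian updating. It involves no strategy: both players randomise on the basis of the
  public history alone, so an observed action pair says nothing about the current state.\<close>

definition belief :: "('k, 'i, 'j) transition \<Rightarrow> 'k \<Rightarrow> ('i, 'j) history \<Rightarrow> 'k pmf" where
  "belief q k1 h = foldl (\<lambda>b (i, j). bind_pmf b (\<lambda>k. q k i j)) (return_pmf k1) h"

lemma belief_simps [simp]: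
  "belief q k1 [] = return_pmf k1"
  "belief q k1 (h @ [(i, j)]) = bind_pmf (belief q k1 h) (\<lambda>k. q k i j)"
  by (simp_all add: belief_def)

primrec history_law ::
  "('i, 'j) strategy1 \<Rightarrow> ('i, 'j) strategy2 \<Rightarrow> nat \<Rightarrow> ('i, 'j) history pmf" where
  "history_law \<sigma> \<tau> 0 = return_pmf []"
| "history_law \<sigma> \<tau> (Suc n) =
     bind_pmf (history_law \<sigma> \<tau> n) (\<lambda>h. map_pmf (\<lambda>a. h @ [a]) (pair_pmf (\<sigma> h) (\<tau> h)))"

text \<open>The state before the actions of stage n is drawn from the belief once the history is known.
  The induction only needs that the draws of the state and of the actions commute, which holds
  because the action laws depend on the history and not on the state.\<close>

lemma history_state_law:
  "bind_pmf (path_pmf q k1 \<sigma> \<tau> n) (\<lambda>\<omega>. map_pmf (Pair (past_actions \<omega> n)) (state_law q k1 n \<omega>)) =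
   bind_pmf (history_law \<sigma> \<tau> n) (\<lambda>h. map_pmf (Pair h) (belief q k1 h))"
proof (induction n)
  case 0
  show ?case by (simp add: bind_return_pmf past_actions_def state_law_def)
next
  case (Suc n)
  let ?step = "\<lambda>(h, k). bind_pmf (pair_pmf (\<sigma> h) (\<tau> h)) (\<lambda>(i, j). map_pmf (Pair (h @ [(i, j)])) (q k i j))"
  have past: "past_actions (fun_upd \<omega> n x) (Suc n) = past_actions \<omega> n @ [snd x]" for \<omega> :: "('k,'i,'j) play" and x
    by (simp add: past_actions_def)
  have "bind_pmf (path_pmf q k1 \<sigma> \<tau> (Suc n))
        (\<lambda>\<omega>. map_pmf (Pair (past_actions \<omega> (Suc n))) (state_law q k1 (Suc n) \<omega>)) =
      bind_pmf (path_pmf q k1 \<sigma> \<tau> n) (\<lambda>\<omega>. bind_pmf (stage_law q k1 \<sigma> \<tau> n \<omega>)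
        (\<lambda>x. map_pmf (Pair (past_actions \<omega> n @ [snd x])) (case x of (k, i, j) \<Rightarrow> q k i j)))"
    by (simp add: bind_assoc_pmf bind_map_pmf past state_law_def)
  also have "\<dots> = bind_pmf (bind_pmf (path_pmf q k1 \<sigma> \<tau> n)
        (\<lambda>\<omega>. map_pmf (Pair (past_actions \<omega> n)) (state_law q k1 n \<omega>))) ?step"
    by (simp add: bind_assoc_pmf bind_map_pmf stage_law_def pair_pmf_def bind_return_pmf)
  also have "\<dots> = bind_pmf (history_law \<sigma> \<tau> n) (\<lambda>h. bind_pmf (belief q k1 h)
        (\<lambda>k. bind_pmf (pair_pmf (\<sigma> h) (\<tau> h)) (\<lambda>(i, j). map_pmf (Pair (h @ [(i, j)])) (q k i j))))"
    by (simp add: Suc.IH bind_assoc_pmf bind_map_pmf)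
  also have "\<dots> = bind_pmf (history_law \<sigma> \<tau> n) (\<lambda>h. bind_pmf (pair_pmf (\<sigma> h) (\<tau> h))
        (\<lambda>(i, j). map_pmf (Pair (h @ [(i, j)])) (belief q k1 (h @ [(i, j)]))))"
    by (subst bind_commute_pmf) (simp add: map_bind_pmf case_prod_unfold)
  finally show ?case
    by (simp only: history_law.simps bind_assoc_pmf bind_map_pmf case_prod_unfold prod.collapse)
qed

lemma state_distribution:
  fixes q :: "('k::finite, 'i::finite, 'j::finite) transition"
  shows "distr (play_measure q k1 \<sigma> \<tau>) (count_space UNIV) (\<lambda>\<omega>. fst (\<omega> n)) =
     measure_pmf (bind_pmf (history_law \<sigma> \<tau> n) (belief q k1))"
proof -
  have "map_pmf (\<lambda>\<omega>. fst (\<omega> n)) (path_pmf q k1 \<sigma> \<tau> (Suc n)) =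
      bind_pmf (path_pmf q k1 \<sigma> \<tau> n) (state_law q k1 n)"
    by (simp add: map_bind_pmf pmf.map_comp comp_def stage_law_def map_fst_pair_pmf)
  also have "\<dots> = map_pmf snd (bind_pmf (path_pmf q k1 \<sigma> \<tau> n)
      (\<lambda>\<omega>. map_pmf (Pair (past_actions \<omega> n)) (state_law q k1 n \<omega>)))"
    by (simp add: map_bind_pmf pmf.map_comp comp_def)
  also have "\<dots> = bind_pmf (history_law \<sigma> \<tau> n) (belief q k1)"
    by (simp add: history_state_law map_bind_pmf pmf.map_comp comp_def)
  finally have law: "map_pmf (\<lambda>\<omega>. fst (\<omega> n)) (path_pmf q k1 \<sigma> \<tau> (Suc n)) =
      bind_pmf (history_law \<sigma> \<tau> n) (belief q k1)" .
  show ?thesis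
    using distr_play_measure(2)[of "\<lambda>\<omega>. fst (\<omega> n)" "Suc n" q k1 \<sigma> \<tau>] by (simp only: law restrict_apply atLeastLessThan_iff)
      simp
qed

section \<open>Verifying a discounted value\<close>

lemma expectation_bind_pmf_finite:
  fixes h :: "'b \<Rightarrow> real"
  assumes "finite (set_pmf p)" and "\<And>x. x \<in> set_pmf p \<Longrightarrow> finite (set_pmf (f x))"
  shows "measure_pmf.expectation (bind_pmf p f) h =
    measure_pmf.expectation p (\<lambda>x. measure_pmf.expectation (f x) h)"
  by (subst pmf_expectation_bind[of "set_pmf p"]) (use assms in \<open>auto simp: integral_measure_pmf[of "set_pmf p"]\<close>)

lemma finite_set_history_law [simp]:
  "finite (set_pmf (history_law (\<sigma> :: ('i::finite, 'j::finite) strategy1) \<tau> n))"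
  by (induction n) auto

definition stage_gain :: "('k, 'i, 'j) transition \<Rightarrow> ('k \<Rightarrow> real) \<Rightarrow> 'k \<Rightarrow> ('i, 'j) history \<Rightarrow> real" where
  "stage_gain q g k1 h = measure_pmf.expectation (belief q k1 h) g"

text \<open>Together with the belief, this turns the game with a hidden state into one in which the
  history is the state and is observed by both players.\<close>

lemma discounted_payoff_sums:
  fixes q :: "('k::finite, 'i::finite, 'j::finite) transition"
  assumes lam: "0 < lam" "lam \<le> 1"
  shows "(\<lambda>n. lam * (1 - lam) ^ n * measure_pmf.expectation (history_law \<sigma> \<tau> n) (stage_gain q g k1))
    sums discounted_payoff q g lam k1 \<sigma> \<tau>"
proof -
  let ?P = "play_measure q k1 \<sigma> \<tau>"
  interpret P: prob_space ?P
    by (rule prob_space_play_measure)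
  define M where "M = Max (range (\<lambda>k. \<bar>g k\<bar>))"
  have M: "\<bar>g k\<bar> \<le> M" for k
    unfolding M_def by (rule Max_ge) auto
  have st [measurable]: "(\<lambda>\<omega>. fst (\<omega> n)) \<in> measurable ?P (count_space UNIV)" for n
    by (rule distr_play_measure(1)[of _ "Suc n"]) simp
  have meas [measurable]: "(\<lambda>\<omega>. g (fst (\<omega> n))) \<in> borel_measurable ?P" for n
    by (rule measurable_compose[OF st]) simp
  have stage: "(\<integral>\<omega>. g (fst (\<omega> n)) \<partial>?P) =
      measure_pmf.expectation (history_law \<sigma> \<tau> n) (stage_gain q g k1)" for n
  proof -
    have "(\<integral>\<omega>. g (fst (\<omega> n)) \<partial>?P) = (\<integral>k. g k \<partial>distr ?P (count_space UNIV) (\<lambda>\<omega>. fst (\<omega> n)))"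
      by (subst integral_distr) auto
    also have "\<dots> = measure_pmf.expectation (bind_pmf (history_law \<sigma> \<tau> n) (belief q k1)) g"
      by (simp only: state_distribution)
    also have "\<dots> = measure_pmf.expectation (history_law \<sigma> \<tau> n) (stage_gain q g k1)"
      unfolding stage_gain_def[abs_def] by (rule expectation_bind_pmf_finite) auto
    finally show ?thesis .
  qed
  have int: "integrable ?P (\<lambda>\<omega>. lam * (1 - lam) ^ n * g (fst (\<omega> n)))" for n
    by (rule integrable_mult_right, rule P.integrable_const_bound[where B=M]) (auto simp: M)
  have bound: "norm (lam * (1 - lam) ^ n * g k) \<le> lam * (1 - lam) ^ n * M" for n k
    using lam M[of k] by (simp add: abs_mult mult_left_mono)
  have summ: "summable (\<lambda>n. lam * (1 - lam) ^ n * M)"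
    by (intro summable_mult2 summable_mult summable_geometric) (use lam in auto)
  have "(\<lambda>n. \<integral>\<omega>. lam * (1 - lam) ^ n * g (fst (\<omega> n)) \<partial>?P) sums
      (\<integral>\<omega>. (\<Sum>n. lam * (1 - lam) ^ n * g (fst (\<omega> n))) \<partial>?P)"
  proof (rule sums_integral[OF int])
    show "AE \<omega> in ?P. summable (\<lambda>n. norm (lam * (1 - lam) ^ n * g (fst (\<omega> n))))"
      by (intro AE_I2 summable_comparison_test'[OF summ, of 0]) (use bound in auto)
    show "summable (\<lambda>n. \<integral>\<omega>. norm (lam * (1 - lam) ^ n * g (fst (\<omega> n))) \<partial>?P)"
    proof (rule summable_comparison_test'[OF summ, of 0])
      fix n :: nat
      have "(\<integral>\<omega>. norm (lam * (1 - lam) ^ n * g (fst (\<omega> n))) \<partial>?P) \<le> (\<integral>\<omega>. lam * (1 - lam) ^ n * M \<partial>?P)"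
        by (intro integral_mono integrable_norm int bound) simp
      then show "norm (\<integral>\<omega>. norm (lam * (1 - lam) ^ n * g (fst (\<omega> n))) \<partial>?P) \<le> lam * (1 - lam) ^ n * M"
        by (simp add: P.prob_space)
    qed
  qed
  then show ?thesis
    by (simp add: discounted_payoff_def stage)
qed

text \<open>Telescoping: U n is what is claimed to remain from stage n on, and the boundedness of U makes the
  remainder vanish because of discounting.\<close>

lemma discounted_sum_ge:
  fixes U x :: "nat \<Rightarrow> real"
  assumes lam: "0 < lam" "lam \<le> 1"
    and sums: "(\<lambda>n. lam * (1 - lam) ^ n * x n) sums S"
    and step: "\<And>n. U n \<le> lam * x n + (1 - lam) * U (Suc n)"
    and bound: "\<And>n. \<bar>U n\<bar> \<le> C"
  shows "U 0 \<le> S"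
proof -
  have partial: "U 0 \<le> (\<Sum>k<n. lam * (1 - lam) ^ k * x k) + (1 - lam) ^ n * U n" for n
  proof (induction n)
    case (Suc n)
    have "(1 - lam) ^ n * U n \<le> (1 - lam) ^ n * (lam * x n + (1 - lam) * U (Suc n))"
      using step lam by (intro mult_left_mono) auto
    with Suc show ?case
      by (simp add: algebra_simps)
  qed simp
  have pow: "(\<lambda>n. (1 - lam) ^ n) \<longlonglongrightarrow> 0"
    using lam by (intro LIMSEQ_power_zero) auto
  have "(\<lambda>n. (1 - lam) ^ n * U n) \<longlonglongrightarrow> 0"
  proof (rule Lim_null_comparison)
    show "\<forall>\<^sub>F n in sequentially. norm ((1 - lam) ^ n * U n) \<le> (1 - lam) ^ n * C"
      using lam bound by (intro always_eventually) (auto simp: abs_mult intro!: mult_left_mono)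
    show "(\<lambda>n. (1 - lam) ^ n * C) \<longlonglongrightarrow> 0"
      using tendsto_mult_right[OF pow, of C] by simp
  qed
  with sums have "(\<lambda>n. (\<Sum>k<n. lam * (1 - lam) ^ k * x k) + (1 - lam) ^ n * U n) \<longlonglongrightarrow> S + 0"
    unfolding sums_def by (rule tendsto_add)
  from LIMSEQ_le_const[OF this, of "U 0"] partial show ?thesis
    by auto
qed

lemma discounted_sum_le:
  fixes U x :: "nat \<Rightarrow> real"
  assumes "0 < lam" "lam \<le> 1"
    and "(\<lambda>n. lam * (1 - lam) ^ n * x n) sums S"
    and "\<And>n. lam * x n + (1 - lam) * U (Suc n) \<le> U n"
    and "\<And>n. \<bar>U n\<bar> \<le> C"
  shows "S \<le> U 0"
  using discounted_sum_ge[of lam "\<lambda>n. - x n" "- S" "\<lambda>n. - U n" C] assms sums_minus[OF assms(3)]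
  by (simp add: algebra_simps)

lemma expectation_history_law_Suc:
  fixes \<sigma> :: "('i::finite, 'j::finite) strategy1" and u :: "('i, 'j) history \<Rightarrow> real"
  shows "measure_pmf.expectation (history_law \<sigma> \<tau> (Suc n)) u =
    measure_pmf.expectation (history_law \<sigma> \<tau> n)
      (\<lambda>h. measure_pmf.expectation (pair_pmf (\<sigma> h) (\<tau> h)) (\<lambda>a. u (h @ [a])))"
  by (simp add: expectation_bind_pmf_finite)

lemma expectation_pair_pmf_finite:
  fixes p :: "('a::finite) pmf" and r :: "('b::finite) pmf" and f :: "'a \<times> 'b \<Rightarrow> real"
  shows "measure_pmf.expectation (pair_pmf p r) f =
      measure_pmf.expectation p (\<lambda>i. measure_pmf.expectation r (\<lambda>j. f (i, j)))"
    and "measure_pmf.expectation (pair_pmf p r) f =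
      measure_pmf.expectation r (\<lambda>j. measure_pmf.expectation p (\<lambda>i. f (i, j)))"
proof -
  show *: "measure_pmf.expectation (pair_pmf p r) f =
      measure_pmf.expectation p (\<lambda>i. measure_pmf.expectation r (\<lambda>j. f (i, j)))"
    for p :: "('a::finite) pmf" and r :: "('b::finite) pmf" and f :: "'a \<times> 'b \<Rightarrow> real"
    by (simp add: pair_pmf_def expectation_bind_pmf_finite)
  have "pair_pmf p r = bind_pmf r (\<lambda>j. bind_pmf p (\<lambda>i. return_pmf (i, j)))"
    unfolding pair_pmf_def by (rule bind_commute_pmf)
  then show "measure_pmf.expectation (pair_pmf p r) f =
      measure_pmf.expectation r (\<lambda>j. measure_pmf.expectation p (\<lambda>i. f (i, j)))"
    by (simp add: expectation_bind_pmf_finite)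
qed

text \<open>If u does not exceed what one stage with \<open>\<sigma>\<close> followed by u yields, whichever action Player 2 takes,
  then \<open>\<sigma>\<close> guarantees u. Checking pure actions of Player 2 is enough since the
  condition is affine in the mixed action.\<close>

lemma discounted_payoff_ge:
  fixes q :: "('k::finite, 'i::finite, 'j::finite) transition"
  assumes lam: "0 < lam" "lam \<le> 1"
    and bound: "\<And>h. \<bar>u h\<bar> \<le> C"
    and step: "\<And>h j. u h \<le> lam * stage_gain q g k1 h +
      (1 - lam) * measure_pmf.expectation (\<sigma> h) (\<lambda>i. u (h @ [(i, j)]))"
  shows "u [] \<le> discounted_payoff q g lam k1 \<sigma> \<tau>"
proof -
  let ?E = "\<lambda>n. measure_pmf.expectation (history_law \<sigma> \<tau> n)"
  have int: "integrable (measure_pmf (history_law \<sigma> \<tau> n)) f" for n and f :: "_ \<Rightarrow> real"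
    by (rule integrable_measure_pmf_finite) simp
  have one: "u h \<le> lam * stage_gain q g k1 h +
      (1 - lam) * measure_pmf.expectation (pair_pmf (\<sigma> h) (\<tau> h)) (\<lambda>a. u (h @ [a]))" for h
  proof -
    have "u h = measure_pmf.expectation (\<tau> h) (\<lambda>j. u h)" by simp
    also have "\<dots> \<le> measure_pmf.expectation (\<tau> h) (\<lambda>j. lam * stage_gain q g k1 h +
        (1 - lam) * measure_pmf.expectation (\<sigma> h) (\<lambda>i. u (h @ [(i, j)])))"
      by (intro integral_mono integrable_measure_pmf_finite step) auto
    also have "\<dots> = lam * stage_gain q g k1 h +
        (1 - lam) * measure_pmf.expectation (\<tau> h) (\<lambda>j. measure_pmf.expectation (\<sigma> h) (\<lambda>i. u (h @ [(i, j)])))"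
      by (subst Bochner_Integration.integral_add) (auto intro!: integrable_measure_pmf_finite)
    finally show ?thesis
      by (simp add: expectation_pair_pmf_finite(2))
  qed
  have "?E 0 u \<le> discounted_payoff q g lam k1 \<sigma> \<tau>"
  proof (rule discounted_sum_ge[OF lam discounted_payoff_sums[OF lam]])
    fix n
    have "?E n u \<le> ?E n (\<lambda>h. lam * stage_gain q g k1 h +
      (1 - lam) * measure_pmf.expectation (pair_pmf (\<sigma> h) (\<tau> h)) (\<lambda>a. u (h @ [a])))"
      by (intro integral_mono int one)
    also have "\<dots> = lam * ?E n (stage_gain q g k1) + (1 - lam) * ?E (Suc n) u"
      by (subst Bochner_Integration.integral_add) (simp_all only: int expectation_history_law_Suc integral_mult_right_zero)
    finally show "?E n u \<le> lam * ?E n (stage_gain q g k1) + (1 - lam) * ?E (Suc n) u" .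
    have "\<bar>?E n u\<bar> \<le> ?E n (\<lambda>h. \<bar>u h\<bar>)"
      using integral_norm_bound[of _ u] by simp
    also have "\<dots> \<le> ?E n (\<lambda>h. C)"
      by (intro integral_mono int bound)
    finally show "\<bar>?E n u\<bar> \<le> C" by simp
  qed
  then show ?thesis by simp
qed

lemma discounted_payoff_le:
  fixes q :: "('k::finite, 'i::finite, 'j::finite) transition"
  assumes lam: "0 < lam" "lam \<le> 1"
    and bound: "\<And>h. \<bar>u h\<bar> \<le> C"
    and step: "\<And>h i. lam * stage_gain q g k1 h +
      (1 - lam) * measure_pmf.expectation (\<tau> h) (\<lambda>j. u (h @ [(i, j)])) \<le> u h"
  shows "discounted_payoff q g lam k1 \<sigma> \<tau> \<le> u []"
proof -
  let ?E = "\<lambda>n. measure_pmf.expectation (history_law \<sigma> \<tau> n)"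
  have int: "integrable (measure_pmf (history_law \<sigma> \<tau> n)) f" for n and f :: "_ \<Rightarrow> real"
    by (rule integrable_measure_pmf_finite) simp
  have one: "lam * stage_gain q g k1 h +
      (1 - lam) * measure_pmf.expectation (pair_pmf (\<sigma> h) (\<tau> h)) (\<lambda>a. u (h @ [a])) \<le> u h" for h
  proof -
    have "lam * stage_gain q g k1 h +
        (1 - lam) * measure_pmf.expectation (\<sigma> h) (\<lambda>i. measure_pmf.expectation (\<tau> h) (\<lambda>j. u (h @ [(i, j)]))) =
        measure_pmf.expectation (\<sigma> h) (\<lambda>i. lam * stage_gain q g k1 h +
        (1 - lam) * measure_pmf.expectation (\<tau> h) (\<lambda>j. u (h @ [(i, j)])))"
      by (subst Bochner_Integration.integral_add) (auto intro!: integrable_measure_pmf_finite)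
    also have "\<dots> \<le> measure_pmf.expectation (\<sigma> h) (\<lambda>i. u h)"
      by (intro integral_mono integrable_measure_pmf_finite step) auto
    finally show ?thesis
      by (simp add: expectation_pair_pmf_finite(1))
  qed
  have "discounted_payoff q g lam k1 \<sigma> \<tau> \<le> ?E 0 u"
  proof (rule discounted_sum_le[OF lam discounted_payoff_sums[OF lam]])
    fix n
    have "lam * ?E n (stage_gain q g k1) + (1 - lam) * ?E (Suc n) u = ?E n (\<lambda>h. lam * stage_gain q g k1 h +
      (1 - lam) * measure_pmf.expectation (pair_pmf (\<sigma> h) (\<tau> h)) (\<lambda>a. u (h @ [a])))"
      by (subst Bochner_Integration.integral_add) (simp_all only: int expectation_history_law_Suc integral_mult_right_zero)
    also have "\<dots> \<le> ?E n u"
      by (intro integral_mono int one)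
    finally show "lam * ?E n (stage_gain q g k1) + (1 - lam) * ?E (Suc n) u \<le> ?E n u" .
    have "\<bar>?E n u\<bar> \<le> ?E n (\<lambda>h. \<bar>u h\<bar>)"
      using integral_norm_bound[of _ u] by simp
    also have "\<dots> \<le> ?E n (\<lambda>h. C)"
      by (intro integral_mono int bound)
    finally show "\<bar>?E n u\<bar> \<le> C" by simp
  qed
  then show ?thesis by simp
qed

lemma abs_discounted_payoff_le:
  fixes q :: "('k::finite, 'i::finite, 'j::finite) transition"
  assumes lam: "0 < lam" "lam \<le> 1" and M: "\<And>k. \<bar>g k\<bar> \<le> M"
  shows "\<bar>discounted_payoff q g lam k1 \<sigma> \<tau>\<bar> \<le> M"
proof -
  have int: "integrable (measure_pmf (belief q k1 h)) f" for h and f :: "_ \<Rightarrow> real"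
    by (rule integrable_measure_pmf_finite) simp
  have "measure_pmf.expectation (belief q k1 h) (\<lambda>_. - M) \<le> stage_gain q g k1 h" for h
    unfolding stage_gain_def using M by (intro integral_mono int) (simp add: abs_le_iff minus_le_iff)
  moreover have "stage_gain q g k1 h \<le> measure_pmf.expectation (belief q k1 h) (\<lambda>_. M)" for h
    unfolding stage_gain_def using M by (intro integral_mono int) (simp add: abs_le_iff)
  ultimately have G: "- M \<le> stage_gain q g k1 h" "stage_gain q g k1 h \<le> M" for h
    by simp_all
  have "- M \<le> discounted_payoff q g lam k1 \<sigma> \<tau>"
  proof (rule discounted_payoff_ge[OF lam, where u = "\<lambda>_. - M" and C = "\<bar>M\<bar>"])
    fix h j
    show "- M \<le> lam * stage_gain q g k1 h + (1 - lam) * measure_pmf.expectation (\<sigma> h) (\<lambda>i. - M)"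
      using mult_left_mono[OF G(1)[of h], of lam] lam by (simp add: algebra_simps)
  qed simp
  moreover have "discounted_payoff q g lam k1 \<sigma> \<tau> \<le> M"
  proof (rule discounted_payoff_le[OF lam, where u = "\<lambda>_. M" and C = "\<bar>M\<bar>"])
    fix h i
    show "lam * stage_gain q g k1 h + (1 - lam) * measure_pmf.expectation (\<tau> h) (\<lambda>i. M) \<le> M"
      using mult_left_mono[OF G(2)[of h], of lam] lam by (simp add: algebra_simps)
  qed simp
  ultimately show ?thesis by (simp add: abs_le_iff)
qed

lemma saddle_point_minimax:
  fixes D :: "'a \<Rightarrow> 'b \<Rightarrow> real"
  assumes D: "\<And>x y. \<bar>D x y\<bar> \<le> M" and x: "\<And>y. v \<le> D x0 y" and y: "\<And>x. D x y0 \<le> v"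
  shows "(SUP x. INF y. D x y) = v" and "(INF y. SUP x. D x y) = v"
proof -
  have ab: "- M \<le> D x y" "D x y \<le> M" for x y
    using D[of x y] by (auto simp: abs_le_iff)
  have bdd: "bdd_below (range (\<lambda>y. D x y))" "bdd_above (range (\<lambda>x. D x y))" for x y
    using ab by (auto intro!: bdd_belowI[of _ "- M"] bdd_aboveI[of _ M])
  have lo: "(INF y. D x y) \<le> v" for x
    using cINF_lower[OF bdd(1), of y0 x] y[of x] by auto
  have hi: "v \<le> (SUP x. D x y)" for y
    using cSUP_upper[OF _ bdd(2), of x0 y] x[of y] by auto
  show "(SUP x. INF y. D x y) = v"
  proof (rule antisym)
    show "(SUP x. INF y. D x y) \<le> v" by (intro cSUP_least lo) auto
    have "v \<le> (INF y. D x0 y)" by (intro cINF_greatest x) auto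
    also have "\<dots> \<le> (SUP x. INF y. D x y)"
      by (intro cSUP_upper) (use lo in \<open>auto intro!: bdd_aboveI[of _ v]\<close>)
    finally show "v \<le> (SUP x. INF y. D x y)" .
  qed
  show "(INF y. SUP x. D x y) = v"
  proof (rule antisym)
    show "v \<le> (INF y. SUP x. D x y)" by (intro cINF_greatest hi) auto
    have "(INF y. SUP x. D x y) \<le> (SUP x. D x y0)"
      by (intro cINF_lower) (use hi in \<open>auto intro!: bdd_belowI[of _ v]\<close>)
    also have "\<dots> \<le> v" by (intro cSUP_least y) auto
    finally show "(INF y. SUP x. D x y) \<le> v" .
  qed
qed

text \<open>A function of the history that both players can guarantee by local optimality is the value.
  This yields existence of the value as well, without a minimax theorem: the saddle point is
  given.\<close>

theorem discounted_value_eqI: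
  fixes q :: "('k::finite, 'i::finite, 'j::finite) transition"
  assumes lam: "0 < lam" "lam \<le> 1"
    and bound: "\<And>h. \<bar>u h\<bar> \<le> C"
    and ge: "\<And>h j. u h \<le> lam * stage_gain q g k1 h +
      (1 - lam) * measure_pmf.expectation (\<sigma> h) (\<lambda>i. u (h @ [(i, j)]))"
    and le: "\<And>h i. lam * stage_gain q g k1 h +
      (1 - lam) * measure_pmf.expectation (\<tau> h) (\<lambda>j. u (h @ [(i, j)])) \<le> u h"
  shows "discounted_value q g lam k1 = u []"
proof -
  define M where "M = Max (range (\<lambda>k. \<bar>g k\<bar>))"
  have M: "\<bar>g k\<bar> \<le> M" for k
    unfolding M_def by (rule Max_ge) auto
  have payoffs: "\<bar>discounted_payoff q g lam k1 \<sigma>' \<tau>'\<bar> \<le> M" for \<sigma>' \<tau>'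
    by (rule abs_discounted_payoff_le[OF lam]) (rule M)
  have "is_discounted_value q g lam k1 (u [])"
    unfolding is_discounted_value_def
    using saddle_point_minimax[of "discounted_payoff q g lam k1" M "u []" \<sigma> \<tau>, OF payoffs]
      discounted_payoff_ge[where \<sigma> = \<sigma>, OF lam bound ge]
      discounted_payoff_le[where \<tau> = \<tau>, OF lam bound le] by blast
  then show ?thesis
    unfolding discounted_value_def by (intro the_equality) (auto simp: is_discounted_value_def)
qed

section \<open>Common beliefs and the value of the game\<close>

lemma UNIV_state: "(UNIV :: state set) = {K1s, K1pp, K1T, K1p, K0s, K0pp, K0p}"
  using state.exhaust by blast

lemma pmf_mix:
  assumes "0 \<le> p" "p \<le> 1"
  shows "pmf (mix p a b) x = p * indicator {a} x + (1 - p) * indicator {b} x"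
proof -
  have "mix p a b = bind_pmf (bernoulli_pmf p) (\<lambda>t. return_pmf (if t then a else b))"
    by (simp add: mix_def map_pmf_def)
  then show ?thesis
    using assms by (simp add: pmf_bind split: split_indicator)
qed

lemma expectation_mix:
  fixes f :: "'a \<Rightarrow> real"
  assumes "0 \<le> p" "p \<le> 1"
  shows "measure_pmf.expectation (mix p a b) f = p * f a + (1 - p) * f b"
  using assms by (simp add: mix_def)

text \<open>In phase High the payoff is 1 and the number is the current run of mismatches; in phase Low the
  payoff is 0 and the number is the current run of matches.\<close>

datatype phase = High nat | Low nat

text \<open>The probability that quitting now leads to the absorbing state that is bad for the quitting player.\<close>

fun risk :: "phase \<Rightarrow> real" where
  "risk (High n) = (1/4) ^ (n div 2)"
| "risk (Low n) = (1/2) ^ n"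

lemma risk_High_Suc:
  "even n \<Longrightarrow> risk (High (Suc n)) = risk (High n)"
  "odd n \<Longrightarrow> risk (High (Suc n)) = risk (High n) / 4"
  by (auto elim!: evenE oddE)

lemma risk_bounds: "0 < risk p" "risk p \<le> 1"
  by (cases p; simp add: power_le_one)+

text \<open>The conditional law of the state, given that it is not absorbing.\<close>

fun phase_law :: "phase \<Rightarrow> state \<Rightarrow> real" where
  "phase_law (High n) k = (if k = K1p then 1 - risk (High n)
     else if k = (if even n then K1pp else K1T) then risk (High n) else 0)"
| "phase_law (Low n) k = (if k = K0p then 1 - risk (Low n)
     else if k = K0pp then risk (Low n) else 0)"

text \<open>A triple (c, r, p) summarises a belief: c is the probability of the absorbing state with payoff 1,
  r the probability of not being absorbed, and p the phase.\<close>

fun summary_mass :: "real \<times> real \<times> phase \<Rightarrow> state \<Rightarrow> real" where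
  "summary_mass (c, r, p) k =
     (if k = K1s then c else if k = K0s then 1 - c - r else r * phase_law p k)"

text \<open>Quitting by the player who likes the current payoff absorbs the state; Low 0 is then a dummy phase.\<close>

fun update :: "real \<times> real \<times> phase \<Rightarrow> action1 \<times> action2 \<Rightarrow> real \<times> real \<times> phase" where
  "update (c, r, High n) (i, j) =
     (if i = Q1 then (c, 0, Low 0)
      else if j = Q2 then (c + r * risk (High n), r * (1 - risk (High n)), Low 0)
      else (c, r, High (if (i, j) = (T, L) \<or> (i, j) = (B, R) then 0 else Suc n)))"
| "update (c, r, Low n) (i, j) =
     (if j = Q2 then (c + r, 0, Low 0)
      else if i = Q1 then (c, r * (1 - risk (Low n)), High 0)
      else (c, r, Low (if (i, j) = (T, L) \<or> (i, j) = (B, R) then Suc n else 0)))"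

definition summary :: "(action1, action2) history \<Rightarrow> real \<times> real \<times> phase" where
  "summary h = foldl update (0, 1, High 0) h"

lemma summary_simps [simp]:
  "summary [] = (0, 1, High 0)"
  "summary (h @ [a]) = update (summary h) a"
  by (simp_all add: summary_def)

text \<open>The beliefs of the game form a family with these three parameters, closed under every action pair.
  The factor 1/4 in the risk of High arises at odd run lengths: a mismatch at \<open>K1T\<close> sends only 1/4 of the
  mass back to \<open>K1pp\<close>.\<close>

lemma pmf_belief_update:
  assumes b: "\<And>k. pmf b k = summary_mass s k"
  shows "pmf (bind_pmf b (\<lambda>k. transition k i j)) k' = summary_mass (update s (i, j)) k'"
proof -
  obtain c r p where s: "s = (c, r, p)" by (cases s) auto
  have "pmf (bind_pmf b (\<lambda>k. transition k i j)) k' = (\<Sum>k\<in>UNIV. pmf (transition k i j) k' * pmf b k)"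
    by (simp add: pmf_bind integral_measure_pmf_real[of UNIV])
  also have "\<dots> = (\<Sum>k\<in>UNIV. pmf (transition k i j) k' * summary_mass s k)"
    by (simp add: b)
  also have "\<dots> = summary_mass (update s (i, j)) k'"
  proof (cases p)
    case (High n)
    show ?thesis
      unfolding s High UNIV_state
      by (cases "even n"; cases i; cases j; cases k')
         (simp_all add: pmf_mix risk_High_Suc algebra_simps del: risk.simps, simp_all)
  next
    case (Low n)
    show ?thesis
      unfolding s Low UNIV_state
      by (cases i; cases j; cases k') (simp_all add: pmf_mix algebra_simps)
  qed
  finally show ?thesis .
qed

lemma pmf_belief: "pmf (belief transition K1pp h) k = summary_mass (summary h) k"
proof (induction h arbitrary: k rule: rev_induct)
  case Nil
  show ?case by (cases k) simp_all
next
  case (snoc a h)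
  obtain i j where a: "a = (i, j)" by (cases a)
  show ?case
    using pmf_belief_update[OF snoc.IH] by (simp add: a)
qed

fun gain :: "phase \<Rightarrow> real" where
  "gain (High n) = 1" | "gain (Low n) = 0"

lemma stage_gain_summary:
  assumes "summary h = (c, r, p)"
  shows "stage_gain transition payoff K1pp h = c + r * gain p"
proof -
  have "stage_gain transition payoff K1pp h = (\<Sum>k\<in>UNIV. payoff k * summary_mass (c, r, p) k)"
    by (simp add: stage_gain_def integral_measure_pmf_real[of UNIV] pmf_belief assms del: summary_mass.simps)
  also have "\<dots> = c + r * gain p"
    unfolding UNIV_state by (cases p) (simp_all add: payoff_def algebra_simps)
  finally show ?thesis .
qed

lemma summary_nonneg:
  assumes "summary h = (c, r, p)"
  shows "0 \<le> c" "0 \<le> r" "c + r \<le> 1"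
proof -
  have "\<forall>c r p. summary h = (c, r, p) \<longrightarrow> 0 \<le> c \<and> 0 \<le> r \<and> c + r \<le> 1"
  proof (induction h rule: rev_induct)
    case (snoc a h)
    obtain i j where a: "a = (i, j)" by (cases a)
    obtain c r p where s: "summary h = (c, r, p)" by (cases "summary h")
    with snoc have *: "0 \<le> c" "0 \<le> r" "c + r \<le> 1" by auto
    have "0 \<le> r * risk p" "r * risk p \<le> r"
      using * risk_bounds[of p] by (auto simp: mult_left_le)
    with * show ?case
      by (cases p) (auto simp: a s right_diff_distrib split: if_splits)
  qed simp
  with assms show "0 \<le> c" "0 \<le> r" "c + r \<le> 1" by blast+
qed

text \<open>The value is affine in the belief: an absorbed state counts with its payoff, the rest with the value
  v of the phase.\<close>

fun summary_value :: "(phase \<Rightarrow> real) \<Rightarrow> real \<times> real \<times> phase \<Rightarrow> real" where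
  "summary_value v (c, r, p) = c + r * v p"

lemma summary_value_update: "summary_value v (update (c, r, p) (i, j)) = c + r * summary_value v (update (0, 1, p) (i, j))"
  by (cases p) (auto simp: algebra_simps)

text \<open>The first argument of min and max is the continuation of a fair run, the second one is quitting.
  In High the decision belongs to Player 2, in Low to Player 1.\<close>

fun bellman :: "real \<Rightarrow> (phase \<Rightarrow> real) \<Rightarrow> phase \<Rightarrow> real" where
  "bellman lam v (High n) =
     min (lam + (1 - lam) * ((v (High 0) + v (High (Suc n))) / 2))
         (lam + (1 - lam) * (risk (High n) + (1 - risk (High n)) * v (Low 0)))"
| "bellman lam v (Low n) =
     max ((1 - lam) * ((v (Low 0) + v (Low (Suc n))) / 2))
         ((1 - lam) * ((1 - risk (Low n)) * v (High 0)))"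

lemma bellman_mono:
  assumes "0 \<le> lam" "lam \<le> 1" and le: "\<And>p. v p \<le> w p"
  shows "bellman lam v p \<le> bellman lam w p"
proof (cases p)
  case (High n)
  show ?thesis
    unfolding High bellman.simps
    using assms risk_bounds[of "High n"]
    by (intro min.mono add_left_mono mult_left_mono divide_right_mono add_mono le) (auto simp del: risk.simps)
next
  case (Low n)
  show ?thesis
    unfolding Low bellman.simps
    using assms risk_bounds[of "Low n"]
    by (intro max.mono add_left_mono mult_left_mono divide_right_mono add_mono le) (auto simp del: risk.simps)
qed

lemma bellman_bounds:
  assumes lam: "0 \<le> lam" "lam \<le> 1" 
  shows "0 \<le> bellman lam (\<lambda>_. 0) p" "bellman lam (\<lambda>_. 1) p \<le> 1"
  using lam risk_bounds[of p] by (cases p; auto simp: min_le_iff_disj mult_le_one simp del: risk.simps)+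

lemma bellman_High_ge:
  assumes "0 \<le> lam" "lam \<le> 1" and "\<And>p. 0 \<le> v p"
  shows "lam \<le> bellman lam v (High n)"
proof -
  have "0 \<le> (1 - lam) * ((v (High 0) + v (High (Suc n))) / 2)"
    "0 \<le> (1 - lam) * (risk (High n) + (1 - risk (High n)) * v (Low 0))"
    using assms risk_bounds[of "High n"] by (auto simp: less_imp_le simp del: risk.simps)
  then show ?thesis
    unfolding bellman.simps by linarith
qed

lemma bellman_Low_le:
  assumes "0 \<le> lam" "lam \<le> 1" and v: "\<And>p. 0 \<le> v p" "\<And>p. v p \<le> 1"
  shows "bellman lam v (Low n) \<le> 1 - lam"
proof -
  have "(1 - lam) * ((v (Low 0) + v (Low (Suc n))) / 2) \<le> (1 - lam) * 1"
    using assms(1,2) v(2)[of "Low 0"] v(2)[of "Low (Suc n)"] by (intro mult_left_mono) auto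
  moreover have "(1 - lam) * ((1 - risk (Low n)) * v (High 0)) \<le> (1 - lam) * 1"
    using assms(1,2) risk_bounds[of "Low n"] v[of "High 0"]
    by (intro mult_left_mono mult_le_one) (auto simp del: risk.simps)
  ultimately show ?thesis
    by (simp add: max_def split: if_splits)
qed

text \<open>Value iteration from 0 is increasing and bounded, and the Bellman operator at a given phase
  depends continuously on finitely many coordinates, so the pointwise limit is a fixed point.\<close>

lemma bellman_fixpoint:
  assumes lam: "0 \<le> lam" "lam \<le> 1"
  obtains v where "\<And>p. bellman lam v p = v p" "\<And>p. 0 \<le> v p" "\<And>p. v p \<le> 1"
proof -
  define w where "w k = (bellman lam ^^ k) (\<lambda>_. 0)" for k
  have w: "w 0 = (\<lambda>_. 0)" "w (Suc k) = bellman lam (w k)" for k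
    by (simp_all add: w_def)
  have inc: "w k p \<le> w (Suc k) p" for k p
  proof (induction k arbitrary: p)
    case 0
    show ?case using bellman_bounds[OF lam] by (simp add: w)
  next
    case (Suc k)
    then show ?case unfolding w(2) by (intro bellman_mono lam)
  qed
  have le: "w k p \<le> 1" for k p
  proof (induction k arbitrary: p)
    case (Suc k)
    have "bellman lam (w k) p \<le> bellman lam (\<lambda>_. 1) p"
      by (intro bellman_mono lam Suc)
    with bellman_bounds(2)[OF lam] show ?case by (metis order_trans w(2))
  qed (simp add: w)
  have inc': "incseq (\<lambda>k. w k p)" for p
    by (rule incseq_SucI) (rule inc)
  have "\<exists>l. (\<lambda>k. w k p) \<longlonglongrightarrow> l" for p
    using incseq_convergent[OF inc', of p 1] le by metis
  then obtain v where v: "\<And>p. (\<lambda>k. w k p) \<longlonglongrightarrow> v p" by metis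
  show thesis
  proof
    fix p
    have "(\<lambda>k. bellman lam (w k) p) \<longlonglongrightarrow> bellman lam v p"
      by (cases p) (auto intro!: tendsto_intros v simp del: risk.simps)
    moreover have "(\<lambda>k. bellman lam (w k) p) \<longlonglongrightarrow> v p"
      using LIMSEQ_Suc[OF v] by (simp add: w)
    ultimately show "bellman lam v p = v p" by (rule LIMSEQ_unique)
    have "0 \<le> w k p" for k
      using incseqD[OF inc', of 0 k] by (simp add: w)
    then show "0 \<le> v p" by (intro LIMSEQ_le_const[OF v]) auto
    show "v p \<le> 1" by (intro LIMSEQ_le_const2[OF v]) (use le in auto)
  qed
qed

text \<open>Stationary in the phase: Player 1 equalises matches and mismatches, except that he quits in Low
  when quitting attains the maximum in \<open>bellman\<close>.\<close>

definition mix_or_quit1 :: "real \<Rightarrow> (phase \<Rightarrow> real) \<Rightarrow> phase \<Rightarrow> action1 pmf" where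
  "mix_or_quit1 lam v p = (case p of High n \<Rightarrow> mix (1/2) T B
     | Low n \<Rightarrow> if v p = (1 - lam) * ((1 - risk p) * v (High 0)) then return_pmf Q1 else mix (1/2) T B)"

definition mix_or_quit2 :: "real \<Rightarrow> (phase \<Rightarrow> real) \<Rightarrow> phase \<Rightarrow> action2 pmf" where
  "mix_or_quit2 lam v p = (case p of Low n \<Rightarrow> mix (1/2) L R
     | High n \<Rightarrow> if v p = lam + (1 - lam) * (risk p + (1 - risk p) * v (Low 0)) then return_pmf Q2 else mix (1/2) L R)"

text \<open>At each belief the one-stage game is a matching pennies game with a quitting row and a quitting
  column. For the player who likes the current payoff, quitting is the worst choice, and the other
  player compares quitting with the fair mixture. This gives a saddle point at each phase.\<close>

lemma value_eq_fixpoint: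
  assumes lam: "0 < lam" "lam \<le> 1"
    and v: "\<And>p. bellman lam v p = v p" and v0: "\<And>p. 0 \<le> v p" and v1: "\<And>p. v p \<le> 1"
  shows "discounted_value transition payoff lam K1pp = v (High 0)"
proof -
  have int: "integrable (measure_pmf p) f" for p :: "('a::finite) pmf" and f :: "'a \<Rightarrow> real"
    by (rule integrable_measure_pmf_finite) simp
  note eqs = mix_or_quit1_def mix_or_quit2_def expectation_mix add_divide_distrib ac_simps
  have High_ge: "lam \<le> v (High n)" for n
    by (rule bellman_High_ge[of lam v n, unfolded v]) (use lam v0 in auto)
  have Low_le: "v (Low n) \<le> 1 - lam" for n
    by (rule bellman_Low_le[of lam v n, unfolded v]) (use lam v0 v1 in auto)
  have High_eqs: "v (High n) \<le> lam + (1 - lam) * ((v (High 0) + v (High (Suc n))) / 2)"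
      "v (High n) \<le> lam + (1 - lam) * (risk (High n) + (1 - risk (High n)) * v (Low 0))"
      "v (High n) \<noteq> lam + (1 - lam) * (risk (High n) + (1 - risk (High n)) * v (Low 0)) \<Longrightarrow>
        v (High n) = lam + (1 - lam) * ((v (High 0) + v (High (Suc n))) / 2)"
      "lam \<le> v (High n)" for n
    using v[of "High n"] High_ge[of n] unfolding bellman.simps by linarith+
  have Low_eqs: "(1 - lam) * ((v (Low 0) + v (Low (Suc n))) / 2) \<le> v (Low n)"
      "(1 - lam) * ((1 - risk (Low n)) * v (High 0)) \<le> v (Low n)"
      "v (Low n) \<noteq> (1 - lam) * ((1 - risk (Low n)) * v (High 0)) \<Longrightarrow>
        v (Low n) = (1 - lam) * ((v (Low 0) + v (Low (Suc n))) / 2)"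
      "v (Low n) \<le> 1 - lam" for n
    using v[of "Low n"] Low_le[of n] unfolding bellman.simps by linarith+
  have ge: "v p \<le> lam * gain p + (1 - lam) *
      measure_pmf.expectation (mix_or_quit1 lam v p) (\<lambda>i. summary_value v (update (0, 1, p) (i, j)))" for p j
  proof (cases p)
    case (High n)
    show ?thesis
      using High_eqs(1,2)[of n] unfolding \<open>p = High n\<close>
      by (cases j) (simp_all add: eqs del: risk.simps)
  next
    case (Low n)
    show ?thesis
      using Low_eqs(3,4)[of n] unfolding \<open>p = Low n\<close>
      by (cases j; cases "v (Low n) = (1 - lam) * ((1 - risk (Low n)) * v (High 0))")
         (simp_all add: eqs del: risk.simps)
  qed
  have le: "lam * gain p + (1 - lam) *
      measure_pmf.expectation (mix_or_quit2 lam v p) (\<lambda>j. summary_value v (update (0, 1, p) (i, j))) \<le> v p" for p i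
  proof (cases p)
    case (High n)
    show ?thesis
      using High_eqs(3,4)[of n] unfolding \<open>p = High n\<close>
      by (cases i; cases "v (High n) = lam + (1 - lam) * (risk (High n) + (1 - risk (High n)) * v (Low 0))")
         (simp_all add: eqs del: risk.simps)
  next
    case (Low n)
    show ?thesis
      using Low_eqs(1,2)[of n] unfolding \<open>p = Low n\<close>
      by (cases i) (simp_all add: eqs del: risk.simps)
  qed
  define u where "u h = summary_value v (summary h)" for h
  have "discounted_value transition payoff lam K1pp = u []"
  proof (rule discounted_value_eqI[OF lam, where C = 1 and \<sigma> = "\<lambda>h. mix_or_quit1 lam v (snd (snd (summary h)))"
        and \<tau> = "\<lambda>h. mix_or_quit2 lam v (snd (snd (summary h)))"])
    fix h
    obtain c r p where s: "summary h = (c, r, p)" by (cases "summary h")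
    note nn = summary_nonneg[OF s]
    have "0 \<le> r * v p" "r * v p \<le> r"
      using nn v0[of p] v1[of p] by (auto simp: mult_left_le)
    with nn show "\<bar>u h\<bar> \<le> 1"
      by (simp add: u_def s)
    fix j
    have "c + r * v p \<le> c + r * (lam * gain p + (1 - lam) *
      measure_pmf.expectation (mix_or_quit1 lam v p) (\<lambda>i. summary_value v (update (0, 1, p) (i, j))))"
      by (intro add_left_mono mult_left_mono ge nn)
    also have "\<dots> = lam * stage_gain transition payoff K1pp h + (1 - lam) *
      measure_pmf.expectation (mix_or_quit1 lam v p) (\<lambda>i. u (h @ [(i, j)]))"
      by (simp add: u_def s summary_value_update[of v c r] stage_gain_summary[OF s] int algebra_simps)
    finally show "u h \<le> lam * stage_gain transition payoff K1pp h + (1 - lam) *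
      measure_pmf.expectation (mix_or_quit1 lam v (snd (snd (summary h)))) (\<lambda>i. u (h @ [(i, j)]))"
      by (simp add: u_def s)
  next
    fix h i
    obtain c r p where s: "summary h = (c, r, p)" by (cases "summary h")
    note nn = summary_nonneg[OF s]
    have "lam * stage_gain transition payoff K1pp h + (1 - lam) *
      measure_pmf.expectation (mix_or_quit2 lam v p) (\<lambda>j. u (h @ [(i, j)])) =
      c + r * (lam * gain p + (1 - lam) *
      measure_pmf.expectation (mix_or_quit2 lam v p) (\<lambda>j. summary_value v (update (0, 1, p) (i, j))))"
      by (simp add: u_def s summary_value_update[of v c r] stage_gain_summary[OF s] int algebra_simps)
    also have "\<dots> \<le> c + r * v p"
      by (intro add_left_mono mult_left_mono le nn)
    finally show "lam * stage_gain transition payoff K1pp h + (1 - lam) *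
      measure_pmf.expectation (mix_or_quit2 lam v (snd (snd (summary h)))) (\<lambda>j. u (h @ [(i, j)])) \<le> u h"
      by (simp add: u_def s)
  qed
  then show ?thesis by (simp add: u_def)
qed

section \<open>The threshold trade-off and its asymptotics\<close>

text \<open>The stopping problem of one player: w n is the gain after a run of length n, a new run starts with
  probability 1/2 at each stage, and quitting at run length n pays Q (discounted by one stage)
  except with risk r n. For Player 1 in Low, w is the value and Q = X; for Player 2 in High, w is
  1 minus the value and Q = 1 - Y. With X and Y as above, Q - w 0 is X - Y in both cases.\<close>

locale stopping_recursion =
  fixes lam :: real and w r :: "nat \<Rightarrow> real" and Q a :: real
  assumes lam: "0 < lam" "lam < 1" and a: "a = (1 - lam) / 2"
    and rec: "\<And>n. w n = max (a * (w 0 + w (Suc n))) (2 * a * ((1 - r n) * Q))"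
    and r: "\<And>n. 0 \<le> r n" "\<And>n. r n \<le> 1" "\<exists>n. r n < 1"
    and Q: "0 < Q" "Q \<le> 1"
    and bound: "\<And>n. 0 \<le> w n" "\<And>n. w n \<le> 1"
begin

lemma a_pos: "0 < a" "a < 1"
  using lam a by auto

lemma lam_a: "lam = 1 - 2 * a"
  using a by simp

lemma power_ratio:
  assumes "(lam + a ^ Suc N) * x \<le> (1 - a) * a ^ N * (2 * a * y)"
  shows "lam / a ^ Suc N * x + x \<le> (1 + lam) * y"
proof -
  have p: "0 < a ^ Suc N" using a_pos by simp
  have "(lam / a ^ Suc N * x + x) * a ^ Suc N = (lam + a ^ Suc N) * x"
    using a_pos by (simp add: field_simps)
  also have "\<dots> \<le> ((1 + lam) * y) * a ^ Suc N"
    using assms by (simp add: lam_a algebra_simps)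
  finally show ?thesis using p by (simp only: mult_le_cancel_right_pos)
qed

lemma power_ratio':
  assumes "(1 - a) * a ^ N * (2 * a * y) \<le> (lam + a ^ Suc N) * x"
  shows "(1 + lam) * y \<le> lam / a ^ Suc N * x + x"
  using power_ratio[of N "- x" "- y"] assms by (simp add: algebra_simps)

text \<open>Waiting for a run of length n is one admissible policy. Summing the geometric series for the
  restarts gives the factor \<open>lam + a ^ Suc n\<close>.\<close>

lemma wait_ge: "(1 - a) * a ^ n * w n \<le> (lam + a ^ Suc n) * w 0"
proof (induction n)
  case 0
  show ?case by (simp add: lam_a algebra_simps)
next
  case (Suc n)
  have "a * (w 0 + w (Suc n)) \<le> w n"
    using rec[of n] by linarith
  then have "(1 - a) * a ^ n * (a * (w 0 + w (Suc n))) \<le> (1 - a) * a ^ n * w n"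
    using a_pos by (intro mult_left_mono) auto
  with Suc show ?case by (simp add: lam_a algebra_simps)
qed

lemma wait_eq:
  assumes "\<And>k. k < n \<Longrightarrow> w k \<noteq> 2 * a * ((1 - r k) * Q)"
  shows "(1 - a) * a ^ n * w n = (lam + a ^ Suc n) * w 0"
  using assms
proof (induction n)
  case 0
  show ?case by (simp add: lam_a algebra_simps)
next
  case (Suc n)
  have "w n = a * (w 0 + w (Suc n))"
    using rec[of n] Suc.prems[of n] by linarith
  then have "(1 - a) * a ^ n * (a * (w 0 + w (Suc n))) = (1 - a) * a ^ n * w n"
    by simp
  with Suc show ?case by (simp add: lam_a algebra_simps)
qed

text \<open>The gap is at most the cost of any threshold N: the discounted waiting time plus the risk.\<close>

lemma gap_le: "Q - w 0 \<le> w 0 * (lam / a ^ Suc N) + Q * (r N - lam * (1 - r N))"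
proof -
  have "2 * a * ((1 - r N) * Q) \<le> w N"
    using rec[of N] by linarith
  then have "(1 - a) * a ^ N * (2 * a * ((1 - r N) * Q)) \<le> (1 - a) * a ^ N * w N"
    using a_pos by (intro mult_left_mono) auto
  from power_ratio'[OF order_trans[OF this wait_ge]] show ?thesis
    by (simp add: algebra_simps)
qed

text \<open>Never quitting would make w vanish at 0, and then everywhere, although quitting has a positive gain.\<close>

lemma eventually_stops: "\<exists>n. w n = 2 * a * ((1 - r n) * Q)"
proof (rule ccontr)
  assume "\<not> ?thesis"
  then have eq: "(1 - a) * a ^ n * w n = (lam + a ^ Suc n) * w 0" for n
    using wait_eq by blast
  have pow: "(\<lambda>n. a ^ n) \<longlonglongrightarrow> 0"
    using a_pos by (intro LIMSEQ_power_zero) auto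
  have "(\<lambda>n. (1 - a) * a ^ n * w n) \<longlonglongrightarrow> 0"
  proof (rule Lim_null_comparison)
    show "\<forall>\<^sub>F n in sequentially. norm ((1 - a) * a ^ n * w n) \<le> (1 - a) * a ^ n"
      using a_pos bound by (intro always_eventually) (auto simp: abs_mult mult_left_le)
    show "(\<lambda>n. (1 - a) * a ^ n) \<longlonglongrightarrow> 0"
      using tendsto_mult_left[OF pow, of "1 - a"] by simp
  qed
  moreover have "(\<lambda>n. (lam + a ^ Suc n) * w 0) \<longlonglongrightarrow> (lam + 0) * w 0"
    by (intro tendsto_intros LIMSEQ_Suc[OF pow])
  ultimately have "(lam + 0) * w 0 = 0"
    unfolding eq by (metis LIMSEQ_unique)
  then have w0: "w 0 = 0" using lam by simp
  obtain n where n: "r n < 1" using r(3) by blast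
  have "w n = 0"
    using eq[of n] a_pos w0 by simp
  moreover have "0 < 2 * a * ((1 - r n) * Q)"
    using a_pos n Q by simp
  ultimately show False
    using rec[of n] by linarith
qed

text \<open>At the first run length where quitting is optimal, \<open>gap_le\<close> holds with equality. Replacing
  \<open>a\<close> by 1/2 only lowers the cost, and ignoring the discount of the quitting stage and replacing Q
  by w 0 costs at most \<open>lam\<close> each. This is negligible, since the gap will be of the order of the square
  root of \<open>lam\<close>.\<close>

lemma gap_ge:
  assumes c: "\<And>N. c \<le> lam * 2 ^ Suc N + r N"
  shows "c * w 0 - 2 * lam \<le> Q - w 0"
proof -
  define N where "N = (LEAST n. w n = 2 * a * ((1 - r n) * Q))"
  from eventually_stops have N: "w N = 2 * a * ((1 - r N) * Q)"
    unfolding N_def by (rule LeastI_ex)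
  have "(1 - a) * a ^ N * w N = (lam + a ^ Suc N) * w 0"
    by (rule wait_eq) (use not_less_Least in \<open>auto simp: N_def\<close>)
  then have gap: "w 0 * (lam / a ^ Suc N) + Q * (r N - lam * (1 - r N)) \<le> Q - w 0"
    using power_ratio[of N "w 0" "(1 - r N) * Q"] N by (simp add: algebra_simps)
  have "a ^ Suc N \<le> (1/2) ^ Suc N"
    using a_pos a lam by (intro power_mono) auto
  then have "lam * 2 ^ Suc N \<le> lam / a ^ Suc N"
    using a_pos lam by (simp add: field_simps power_one_over)
  then have 1: "w 0 * (lam * 2 ^ Suc N) \<le> w 0 * (lam / a ^ Suc N)"
    using bound by (intro mult_left_mono)
  have "Q * (lam * (1 - r N)) \<le> 1 * lam"
    using Q r(1,2)[of N] lam by (intro mult_mono) (auto simp: mult_left_le)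
  with gap have 2: "w 0 * (lam * 2 ^ Suc N) + Q * r N - lam \<le> Q - w 0"
    using 1 by (simp add: right_diff_distrib)
  have "0 \<le> w 0 * (lam * 2 ^ Suc N)" "0 \<le> Q * r N"
    using bound lam Q r by auto
  with 2 have "w 0 - lam \<le> Q" by linarith
  then have "(w 0 - lam) * r N \<le> Q * r N"
    using r by (intro mult_right_mono)
  moreover have "lam * r N \<le> lam"
    using r lam by (simp add: mult_left_le)
  moreover have "w 0 * c \<le> w 0 * (lam * 2 ^ Suc N + r N)"
    using bound c by (intro mult_left_mono)
  ultimately show ?thesis
    using 2 by (simp add: algebra_simps)
qed

end

text \<open>The two stopping problems share the gap X - Y. Comparing an upper bound from one of them
  with a lower bound from the other one determines X in the limit.\<close>

lemma value_gap_bounds: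
  assumes lam: "0 < lam" "lam < 1" and X: "X = discounted_value transition payoff lam K1pp"
  obtains Y where
    "\<And>N. X - Y \<le>
      (1 - X) * (lam / ((1 - lam) / 2) ^ Suc N) + (1 - Y) * risk (High N)"
    "\<And>N. X - Y \<le>
      Y * (lam / ((1 - lam) / 2) ^ Suc N) + X * risk (Low N)"
    "\<And>c. (\<And>N. c \<le> lam * 2 ^ Suc N + risk (High N)) \<Longrightarrow>
      c * (1 - X) - 2 * lam \<le> X - Y"
    "\<And>c. (\<And>N. c \<le> lam * 2 ^ Suc N + risk (Low N)) \<Longrightarrow>
      c * Y - 2 * lam \<le> X - Y"
    "0 \<le> Y" "Y \<le> 1" "0 \<le> X" "X \<le> 1"
proof -
  obtain v where v: "\<And>p. bellman lam v p = v p" and v0: "\<And>p. 0 \<le> v p" and v1: "\<And>p. v p \<le> 1"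
    using bellman_fixpoint[of lam] lam by auto
  have X: "X = v (High 0)"
    unfolding X using lam by (intro value_eq_fixpoint v v0 v1) auto
  have Xpos: "0 < v (High 0)"
    using bellman_High_ge[of lam v 0, unfolded v] v0 lam by fastforce
  have Ylt: "v (Low 0) < 1"
    using bellman_Low_le[of lam v 0, unfolded v] v0 v1 lam by fastforce
  interpret low: stopping_recursion lam "\<lambda>n. v (Low n)" "\<lambda>n. risk (Low n)" "v (High 0)" "(1 - lam) / 2"
  proof
    show "v (Low n) = max ((1 - lam) / 2 * (v (Low 0) + v (Low (Suc n))))
        (2 * ((1 - lam) / 2) * ((1 - risk (Low n)) * v (High 0)))" for n
    proof -
      have "(1 - lam) / 2 * x = (1 - lam) * (x / 2)" "2 * ((1 - lam) / 2) * x = (1 - lam) * x" for x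
        by simp_all
      then show ?thesis
        using v[of "Low n"] by (simp only: bellman.simps)
    qed
    show "\<exists>n. risk (Low n) < 1" by (rule exI[of _ 1]) simp
  qed (use lam Xpos v0 v1 risk_bounds[of "Low _"] in \<open>auto simp: less_imp_le simp del: risk.simps\<close>)
  interpret high: stopping_recursion lam "\<lambda>n. 1 - v (High n)" "\<lambda>n. risk (High n)" "1 - v (Low 0)" "(1 - lam) / 2"
  proof
    fix n
    have "1 - v (High n) = 1 - min (lam + (1 - lam) * ((v (High 0) + v (High (Suc n))) / 2))
         (lam + (1 - lam) * (risk (High n) + (1 - risk (High n)) * v (Low 0)))"
      using v[of "High n"] by simp
    also have "\<dots> = max (1 - (lam + (1 - lam) * ((v (High 0) + v (High (Suc n))) / 2)))
         (1 - (lam + (1 - lam) * (risk (High n) + (1 - risk (High n)) * v (Low 0))))"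
      by linarith
    also have "1 - (lam + (1 - lam) * ((v (High 0) + v (High (Suc n))) / 2)) =
        (1 - lam) / 2 * ((1 - v (High 0)) + (1 - v (High (Suc n))))"
      by (simp add: field_simps)
    also have "1 - (lam + (1 - lam) * (risk (High n) + (1 - risk (High n)) * v (Low 0))) =
        2 * ((1 - lam) / 2) * ((1 - risk (High n)) * (1 - v (Low 0)))"
      by (simp add: field_simps del: risk.simps)
    finally show "1 - v (High n) = max ((1 - lam) / 2 * ((1 - v (High 0)) + (1 - v (High (Suc n)))))
        (2 * ((1 - lam) / 2) * ((1 - risk (High n)) * (1 - v (Low 0))))" .
    show "\<exists>n. risk (High n) < 1" by (rule exI[of _ 2]) simp
  qed (use lam Ylt v0 v1 risk_bounds[of "High _"] in \<open>auto simp: less_imp_le simp del: risk.simps\<close>)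
  have drop: "Q * (risk p - lam * (1 - risk p)) \<le> Q * risk p" if "0 \<le> Q" for Q p
    using that lam risk_bounds[of p] by (intro mult_left_mono) auto
  show thesis
  proof (rule that[of "v (Low 0)"]; (unfold X)?)
    show "v (High 0) - v (Low 0) \<le>
        (1 - v (High 0)) * (lam / ((1 - lam) / 2) ^ Suc N) + (1 - v (Low 0)) * risk (High N)" for N
      using high.gap_le[of N] drop[of "1 - v (Low 0)" "High N"] v1[of "Low 0"] by linarith
    show "v (High 0) - v (Low 0) \<le>
        v (Low 0) * (lam / ((1 - lam) / 2) ^ Suc N) + v (High 0) * risk (Low N)" for N
      using low.gap_le[of N] drop[of "v (High 0)" "Low N"] v0[of "High 0"] by linarith
    show "c * (1 - v (High 0)) - 2 * lam \<le> v (High 0) - v (Low 0)"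
      if "\<And>N. c \<le> lam * 2 ^ Suc N + risk (High N)" for c
      using high.gap_ge[of c] that by simp
    show "c * v (Low 0) - 2 * lam \<le> v (High 0) - v (Low 0)"
      if "\<And>N. c \<le> lam * 2 ^ Suc N + risk (Low N)" for c
      using low.gap_ge[of c] that by simp
  qed (use v0 v1 in auto)
qed

text \<open>The scale at which the risk \<open>(1/2) ^ m\<close> equals the discounted waiting time for it.\<close>

definition rate :: "nat \<Rightarrow> real" where "rate m = (1/2) ^ (2 * m + 1)"

lemma rate_pos: "0 < rate m" "rate m < 1"
  using power_Suc_less_one[of "1/2 :: real" "2 * m"] by (auto simp: rate_def)

lemma rate_scale: "2 * rate m = ((1/2) ^ m) ^ 2"
  by (simp add: rate_def power_mult [symmetric] mult.commute)

text \<open>The arithmetic-geometric mean inequality, attained at N = m.\<close>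

lemma cost_Low: "2 * (1/2) ^ m \<le> rate m * 2 ^ Suc N + risk (Low N)"
proof -
  have "0 \<le> ((1/2) ^ m * 2 ^ N - 1)\<^sup>2 / (2::real) ^ N" by simp
  also have "\<dots> = ((1/2) ^ m)\<^sup>2 * 2 ^ N + (1/2) ^ N - 2 * (1/2) ^ m"
    by (simp add: power2_eq_square field_simps power_one_over)
  finally show ?thesis by (simp add: rate_scale[symmetric])
qed

text \<open>The same cost with risks that are powers of 1/4. At an even run length
  \<open>2 * j\<close>, the cost relative to \<open>(1/2) ^ (2 * k + 1)\<close> is \<open>z + 1 / z\<close>, where \<open>z = 4 ^ j / 2 ^ (2 * k + 1)\<close> is a
  power of 2 with odd exponent. It avoids the interval between 1/2 and 2, which raises the minimum
  from 2 to 5/2. Odd run lengths cost more time for the same risk.\<close>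

lemma cost_High_odd: "5/2 * (1/2) ^ (2 * k + 1) \<le> rate (2 * k + 1) * 2 ^ Suc N + risk (High N)"
proof -
  define j where "j = N div 2"
  define z :: real where "z = (1/2) ^ (2 * k + 1) * 4 ^ j"
  have sq: "((2::real) ^ k)\<^sup>2 = 4 ^ k"
    by (simp add: power2_eq_square flip: power_mult_distrib)
  have "z \<le> 1/2 \<or> 2 \<le> z"
  proof (cases "j \<le> k")
    case True
    then have "(4::real) ^ j \<le> 4 ^ k" by (intro power_increasing) auto
    then show ?thesis by (simp add: z_def power_mult power_one_over field_simps sq)
  next
    case False
    then have "(4::real) ^ Suc k \<le> 4 ^ j" by (intro power_increasing) auto
    then show ?thesis by (simp add: z_def power_mult power_one_over field_simps sq)
  qed
  then have "0 \<le> (z - 1/2) * (z - 2)"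
    by (auto intro: mult_nonpos_nonpos)
  then have "0 \<le> (z - 1/2) * (z - 2) / 4 ^ j" by simp
  also have "\<dots> = ((1/2) ^ (2 * k + 1))\<^sup>2 * 4 ^ j + (1/4) ^ j - 5/2 * (1/2) ^ (2 * k + 1)"
    by (simp add: z_def power2_eq_square field_simps power_one_over)
  also have "((1/2) ^ (2 * k + 1))\<^sup>2 * (4::real) ^ j \<le> ((1/2) ^ (2 * k + 1))\<^sup>2 * 2 ^ N"
  proof (intro mult_left_mono)
    have "(4::real) ^ j = 2 ^ (2 * j)" by (simp add: power_mult)
    also have "\<dots> \<le> 2 ^ N" by (intro power_increasing) (auto simp: j_def)
    finally show "(4::real) ^ j \<le> 2 ^ N" .
  qed simp
  also have "((1/2) ^ (2 * k + 1))\<^sup>2 * 2 ^ N = rate (2 * k + 1) * 2 ^ Suc N"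
    unfolding rate_scale[symmetric] by simp
  finally show ?thesis by (simp add: j_def)
qed

text \<open>The effect of discounting during the wait, which disappears in the limit since m is logarithmic in
  \<open>1 / rate m\<close>.\<close>

definition slack :: "nat \<Rightarrow> real" where "slack m = 1 / (1 - rate m) ^ Suc m"

lemma rate_slack:
  "rate m / ((1 - rate m) / 2) ^ Suc m = (1/2) ^ m * slack m"
proof -
  have "rate m * 2 ^ Suc m = (1/2) ^ m"
    using rate_scale[of m] by (simp add: power2_eq_square field_simps power_one_over)
  moreover have "rate m / ((1 - rate m) / 2) ^ Suc m = rate m * 2 ^ Suc m / (1 - rate m) ^ Suc m"
    by (simp add: power_divide del: power_Suc)
  ultimately show ?thesis by (simp only: slack_def) simp
qed

lemma slack_tendsto: "slack \<longlonglongrightarrow> 1"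
proof -
  have "(\<lambda>m. (1 - rate m) ^ Suc m) \<longlonglongrightarrow> 1"
  proof (rule tendsto_sandwich)
    show "\<forall>\<^sub>F m in sequentially. 1 - real (Suc m) * rate m \<le> (1 - rate m) ^ Suc m"
      using Bernoulli_inequality[of "- rate _" "Suc _"] rate_pos
      by (intro always_eventually allI) (smt (verit) mult_minus_right)
    show "\<forall>\<^sub>F m in sequentially. (1 - rate m) ^ Suc m \<le> 1"
      using rate_pos by (intro always_eventually allI power_le_one) (auto simp: less_imp_le)
    have "(\<lambda>m. real (Suc m) * rate m) \<longlonglongrightarrow> 0"
      unfolding rate_def by real_asymp
    from tendsto_diff[OF tendsto_const this] show "(\<lambda>m. 1 - real (Suc m) * rate m) \<longlonglongrightarrow> 1"
      by simp
  qed simp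
  from tendsto_divide[OF tendsto_const[of 1] this] show ?thesis
    by (simp add: slack_def[abs_def])
qed

theorem mainTheorem3:
  shows "\<not> (\<exists>l. ((\<lambda>lam. discounted_value transition payoff lam K1pp) \<longlongrightarrow> l) (at_right 0))"
proof
  assume "\<exists>l. ((\<lambda>lam. discounted_value transition payoff lam K1pp) \<longlongrightarrow> l) (at_right 0)"
  then obtain l where l: "((\<lambda>lam. discounted_value transition payoff lam K1pp) \<longlongrightarrow> l) (at_right 0)" ..
  define X where "X m = discounted_value transition payoff (rate m) K1pp" for m
  define \<mu> :: "nat \<Rightarrow> real" where "\<mu> m = (1/2) ^ m" for m
  have \<mu>: "0 < \<mu> m" "2 * rate m = \<mu> m * \<mu> m" for m
    by (auto simp: \<mu>_def rate_scale power2_eq_square)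
  have \<mu>0: "\<mu> \<longlonglongrightarrow> 0"
    unfolding \<mu>_def[abs_def] by (intro LIMSEQ_power_zero) auto
  have rate0: "rate \<longlonglongrightarrow> 0"
    unfolding rate_def[abs_def] by real_asymp
  have "filterlim rate (at_right 0) sequentially"
    by (rule tendsto_imp_filterlim_at_right[OF rate0]) (simp add: rate_pos)
  from filterlim_compose[OF l this] have X: "X \<longlonglongrightarrow> l"
    by (simp add: X_def[abs_def])
  have "\<exists>y.
    (\<forall>N. X m - y \<le> (1 - X m) * (rate m / ((1 - rate m) / 2) ^ Suc N) + (1 - y) * risk (High N)) \<and>
    (\<forall>N. X m - y \<le> y * (rate m / ((1 - rate m) / 2) ^ Suc N) + X m * risk (Low N)) \<and>
    (\<forall>c. (\<forall>N. c \<le> rate m * 2 ^ Suc N + risk (High N)) \<longrightarrow> c * (1 - X m) - 2 * rate m \<le> X m - y) \<and>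
    (\<forall>c. (\<forall>N. c \<le> rate m * 2 ^ Suc N + risk (Low N)) \<longrightarrow> c * y - 2 * rate m \<le> X m - y) \<and>
    0 \<le> y \<and> y \<le> 1 \<and> 0 \<le> X m \<and> X m \<le> 1" for m
    by (rule value_gap_bounds[OF rate_pos X_def[of m]]) blast
  then obtain Y where
    high_le: "\<And>m N. X m - Y m \<le> (1 - X m) * (rate m / ((1 - rate m) / 2) ^ Suc N) + (1 - Y m) * risk (High N)" and
    low_le: "\<And>m N. X m - Y m \<le> Y m * (rate m / ((1 - rate m) / 2) ^ Suc N) + X m * risk (Low N)" and
    high_ge: "\<And>m c. (\<And>N. c \<le> rate m * 2 ^ Suc N + risk (High N)) \<Longrightarrow> c * (1 - X m) - 2 * rate m \<le> X m - Y m" and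
    low_ge: "\<And>m c. (\<And>N. c \<le> rate m * 2 ^ Suc N + risk (Low N)) \<Longrightarrow> c * Y m - 2 * rate m \<le> X m - Y m" and
    bounds: "\<And>m. 0 \<le> Y m" "\<And>m. Y m \<le> 1" "\<And>m. 0 \<le> X m" "\<And>m. X m \<le> 1"
    by metis
  have low_upper: "X m - Y m \<le> \<mu> m * (Y m * slack m + X m)" for m
    using low_le[of m m] unfolding rate_slack by (simp add: \<mu>_def algebra_simps)
  have low_lower: "\<mu> m * (2 * Y m - \<mu> m) \<le> X m - Y m" for m
    using low_ge[of "2 * \<mu> m" m] cost_Low[of m] \<mu>(2)[of m] by (simp add: \<mu>_def algebra_simps)
  have high_upper: "X (2 * k) - Y (2 * k) \<le>
      \<mu> (2 * k) * ((1 - X (2 * k)) * slack (2 * k) + (1 - Y (2 * k)))" for k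
  proof -
    have "risk (High (2 * k)) = \<mu> (2 * k)"
      by (simp add: \<mu>_def power_mult power2_eq_square)
    then show ?thesis
      using high_le[of "2 * k" "2 * k"] unfolding rate_slack by (simp add: \<mu>_def algebra_simps)
  qed
  have high_lower: "\<mu> (2 * k + 1) * (5/2 * (1 - X (2 * k + 1)) - \<mu> (2 * k + 1)) \<le> X (2 * k + 1) - Y (2 * k + 1)" for k
  proof -
    have "5/2 * \<mu> (2 * k + 1) * (1 - X (2 * k + 1)) - 2 * rate (2 * k + 1) \<le> X (2 * k + 1) - Y (2 * k + 1)"
      by (rule high_ge) (unfold \<mu>_def, rule cost_High_odd)
    then show ?thesis
      unfolding \<mu>(2) right_diff_distrib by (simp only: ac_simps)
  qed
  have slack_nonneg: "0 \<le> slack m" for m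
    using rate_pos[of m] by (simp add: slack_def less_imp_le)
  have XY: "(\<lambda>m. X m - Y m) \<longlonglongrightarrow> 0"
  proof (rule tendsto_sandwich)
    show "\<forall>\<^sub>F m in sequentially. \<mu> m * (- \<mu> m) \<le> X m - Y m"
    proof (intro always_eventually allI)
      fix m
      have "\<mu> m * (- \<mu> m) \<le> \<mu> m * (2 * Y m - \<mu> m)"
        using \<mu>(1)[of m] bounds[of m] by (intro mult_left_mono) auto
      with low_lower show "\<mu> m * (- \<mu> m) \<le> X m - Y m" by (rule order_trans[rotated])
    qed
    show "\<forall>\<^sub>F m in sequentially. X m - Y m \<le> \<mu> m * (slack m + 1)"
    proof (intro always_eventually allI)
      fix m
      have "Y m * slack m \<le> slack m"
        using bounds slack_nonneg by (simp add: mult_left_le_one_le)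
      then have "\<mu> m * (Y m * slack m + X m) \<le> \<mu> m * (slack m + 1)"
        using \<mu>(1)[of m] bounds[of m] by (intro mult_left_mono) auto
      with low_upper show "X m - Y m \<le> \<mu> m * (slack m + 1)" by (rule order_trans)
    qed
    show "(\<lambda>m. \<mu> m * (- \<mu> m)) \<longlonglongrightarrow> 0"
      using tendsto_mult[OF \<mu>0 tendsto_minus[OF \<mu>0]] by simp
    show "(\<lambda>m. \<mu> m * (slack m + 1)) \<longlonglongrightarrow> 0"
      using tendsto_mult[OF \<mu>0 tendsto_add[OF slack_tendsto tendsto_const[of 1]]] by simp
  qed
  have Y: "Y \<longlonglongrightarrow> l"
    using tendsto_diff[OF X XY] by simp
  have even: "filterlim (\<lambda>k. 2 * k) sequentially sequentially" and odd: "filterlim (\<lambda>k. 2 * k + 1) sequentially sequentially"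
    by (auto intro!: filterlim_subseq simp: strict_mono_def)
  \<comment> \<open>Even m: both costs are minimal, so the upper bound from High meets the lower bound from Low.\<close>
  have "2 * l - 0 \<le> (1 - l) * 1 + (1 - l)"
  proof (rule LIMSEQ_le)
    show "(\<lambda>k. 2 * Y (2 * k) - \<mu> (2 * k)) \<longlonglongrightarrow> 2 * l - 0"
      by (intro tendsto_intros filterlim_compose[OF _ even] Y \<mu>0)
    show "(\<lambda>k. (1 - X (2 * k)) * slack (2 * k) + (1 - Y (2 * k))) \<longlonglongrightarrow> (1 - l) * 1 + (1 - l)"
      by (intro tendsto_intros filterlim_compose[OF _ even] X Y slack_tendsto)
    show "\<exists>K. \<forall>k\<ge>K. 2 * Y (2 * k) - \<mu> (2 * k) \<le> (1 - X (2 * k)) * slack (2 * k) + (1 - Y (2 * k))"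
      using order_trans[OF low_lower high_upper] \<mu>(1) by (simp only: mult_le_cancel_left_pos) auto
  qed
  \<comment> \<open>Odd m: Player 2 pays 5/2 where Player 1 pays 2.\<close>
  moreover have "5/2 * (1 - l) - 0 \<le> l * 1 + l"
  proof (rule LIMSEQ_le)
    show "(\<lambda>k. 5/2 * (1 - X (2 * k + 1)) - \<mu> (2 * k + 1)) \<longlonglongrightarrow> 5/2 * (1 - l) - 0"
      by (intro tendsto_intros filterlim_compose[OF _ odd] X \<mu>0)
    show "(\<lambda>k. Y (2 * k + 1) * slack (2 * k + 1) + X (2 * k + 1)) \<longlonglongrightarrow> l * 1 + l"
      by (intro tendsto_intros filterlim_compose[OF _ odd] X Y slack_tendsto)
    show "\<exists>K. \<forall>k\<ge>K. 5/2 * (1 - X (2 * k + 1)) - \<mu> (2 * k + 1) \<le> Y (2 * k + 1) * slack (2 * k + 1) + X (2 * k + 1)"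
      using order_trans[OF high_lower low_upper] \<mu>(1) by (simp only: mult_le_cancel_left_pos) auto
  qed
  ultimately show False by (simp add: algebra_simps)
qed

end
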